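(* Let $p\in\Sigma^*$ be a binary pattern with reversal. Then $p$ is $2$-avoidable if and only if $\ell(u)\in S_2$ for some factor $u$ of $p$, where $$S_2=\{xxx,\ xxyxy^R,\ xxyx^Ry,\ xxyxyy,\ xxyx^Ry^R,\ xxyyx,\ xxyyx^R,\ xx^R,\ xyxxy,\ xyx^Rx^Ry,\ xyxyx,\ xyxyx^R,\ xyx^Ryx,\ xyx^Ry^Rx,\ xyyx^R,\ xyxy^Rx,\ xyxy^Rx^R\}.$$
   Context: $\Sigma=\{x,x^R,y,y^R\}$ is a four-letter alphabet; a word $p\in\Sigma^*$ is called a binary pattern with reversal. For a positive integer $k$, $T_k=\{0,1,\ldots,k-1\}$. For a word $w=a_1a_2\cdots a_n\in T_k^*$ ($a_i\in T_k$), $w^R=a_na_{n-1}\cdots a_1$ is its reversal. A morphism $f:\Sigma^*\to T_k^*$ respects reversal if $f(x^R)=f(x)^R$ and $f(y^R)=f(y)^R$. An instance of $p$ is the image of $p$ under some non-erasing morphism that respects reversal (non-erasing: the image of every letter is non-empty). A word $w$ avoids $p$ if no factor (contiguous subword) of $w$ is an instance of $p$. The pattern $p$ is $k$-avoidable if there are arbitrarily long words of $T_k^*$ which avoid $p$. Let $\iota_1,\iota_2$ be the morphisms of $\Sigma^*$ with $\iota_1(x)=x^R$, $\iota_1(x^R)=x$, $\iota_1(y)=y$, $\iota_1(y^R)=y^R$, and $\iota_2(x)=y$, $\iota_2(x^R)=y^R$, $\iota_2(y)=x$, $\iota_2(y^R)=x^R$. Let $\iota_3$ be the reversal antimorphism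 of $\Sigma^*$, $\iota_3(a_1a_2\cdots a_n)=a_n\cdots a_2a_1$ for $a_i\in\Sigma$. Write $p\sim q$ if $q$ is obtained from $p$ by a (finite) sequence of applications of $\iota_1,\iota_2,\iota_3$; this is an equivalence relation on $\Sigma^*$. For $p\in\Sigma^*$, $\ell(p)$ is the least element of the $\sim$-equivalence class of $p$ in the lexicographic order generated by $x<x^R<y<y^R$. (All elements of a class have the same length.) *)

theory Defs
  imports Main "HOL-Library.Sublist" "HOL-Library.List_Lexorder"
begin

datatype letter = X | XR | Y | YR

text \<open>The alphabet is ordered by \<open>X < XR < Y < YR\<close>; the order on \<open>letter list\<close> is then the
  lexicographic one of \<open>List_Lexorder\<close>.\<close>

fun letter_rank :: "letter \<Rightarrow> nat" where
  "letter_rank X = 0"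
| "letter_rank XR = 1"
| "letter_rank Y = 2"
| "letter_rank YR = 3"

lemma letter_rank_inject: "letter_rank a = letter_rank b \<longleftrightarrow> a = b"
  by (cases a; cases b) simp_all

instantiation letter :: linorder
begin

definition less_eq_letter :: "letter \<Rightarrow> letter \<Rightarrow> bool" where
  "a \<le> b \<longleftrightarrow> letter_rank a \<le> letter_rank b"

definition less_letter :: "letter \<Rightarrow> letter \<Rightarrow> bool" where
  "a < b \<longleftrightarrow> letter_rank a < letter_rank b"

instance
  by standard (auto simp: less_eq_letter_def less_letter_def letter_rank_inject)

end

text \<open>The set of words \<open>T\<^sub>k\<^sup>*\<close> is \<open>lists {..<k}\<close>.\<close>

definition morphism :: "nat \<Rightarrow> (letter list \<Rightarrow> nat list) \<Rightarrow> bool" where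
  "morphism k f \<longleftrightarrow> range f \<subseteq> lists {..<k} \<and> (\<forall>u v. f (u @ v) = f u @ f v)"

definition respects_reversal :: "(letter list \<Rightarrow> nat list) \<Rightarrow> bool" where
  "respects_reversal f \<longleftrightarrow> f [XR] = rev (f [X]) \<and> f [YR] = rev (f [Y])"

definition nonerasing :: "(letter list \<Rightarrow> nat list) \<Rightarrow> bool" where
  "nonerasing f \<longleftrightarrow> (\<forall>a. f [a] \<noteq> [])"

definition is_instance :: "nat \<Rightarrow> letter list \<Rightarrow> nat list \<Rightarrow> bool" where
  "is_instance k p v \<longleftrightarrow>
    (\<exists>f. morphism k f \<and> nonerasing f \<and> respects_reversal f \<and> v = f p)"

definition avoids :: "nat \<Rightarrow> nat list \<Rightarrow> letter list \<Rightarrow> bool" where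
  "avoids k w p \<longleftrightarrow> (\<forall>v. sublist v w \<longrightarrow> \<not> is_instance k p v)"

definition avoidable :: "nat \<Rightarrow> letter list \<Rightarrow> bool" where
  "avoidable k p \<longleftrightarrow> (\<forall>n. \<exists>w \<in> lists {..<k}. n \<le> length w \<and> avoids k w p)"

fun flip_x :: "letter \<Rightarrow> letter" where
  "flip_x X = XR"
| "flip_x XR = X"
| "flip_x Y = Y"
| "flip_x YR = YR"

fun swap_xy :: "letter \<Rightarrow> letter" where
  "swap_xy X = Y"
| "swap_xy XR = YR"
| "swap_xy Y = X"
| "swap_xy YR = XR"

definition iota1 :: "letter list \<Rightarrow> letter list" where
  "iota1 = map flip_x"

definition iota2 :: "letter list \<Rightarrow> letter list" where
  "iota2 = map swap_xy"

text \<open>The antimorphism only reverses the order of the letters: it does not exchange \<open>X\<close>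
  with \<open>XR\<close> or \<open>Y\<close> with \<open>YR\<close>.\<close>

definition iota3 :: "letter list \<Rightarrow> letter list" where
  "iota3 = rev"

definition iota_step :: "letter list \<Rightarrow> letter list \<Rightarrow> bool" where
  "iota_step p q \<longleftrightarrow> q = iota1 p \<or> q = iota2 p \<or> q = iota3 p"

definition pattern_equiv :: "letter list \<Rightarrow> letter list \<Rightarrow> bool" where
  "pattern_equiv = iota_step\<^sup>*\<^sup>*"

definition ell :: "letter list \<Rightarrow> letter list" where
  "ell p = (LEAST q. pattern_equiv p q)"

definition S2 :: "letter list set" where
  "S2 = {
    [X, X, X],
    [X, X, Y, X, YR],
    [X, X, Y, XR, Y],
    [X, X, Y, X, Y, Y],
    [X, X, Y, XR, YR],
    [X, X, Y, Y, X],
    [X, X, Y, Y, XR],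
    [X, XR],
    [X, Y, X, X, Y],
    [X, Y, XR, XR, Y],
    [X, Y, X, Y, X],
    [X, Y, X, Y, XR],
    [X, Y, XR, Y, X],
    [X, Y, XR, YR, X],
    [X, Y, Y, XR],
    [X, Y, X, YR, X],
    [X, Y, X, YR, XR]}"

end

theory Submission
  imports Defs
begin

text \<open>Avoidability is invariant under \<open>\<sim>\<close> and passes from a factor to the whole pattern, so only
  two finite tasks remain.

  \<^item> A pattern none of whose factors is equivalent to a member of \<open>S2\<close> has length at most \<open>5\<close> and is
    equivalent to a factor of one of nine patterns. For these one shows that every long binary word
    contains an instance: call a word forced if every sufficiently long two-sided extension of it
    contains an instance. Instances are forced, and a word is forced as soon as both its one-letter
    extensions on one side are; a short derivation of this kind reaches the empty word.

  \<^item> Nine members of \<open>S2\<close> are avoided by periodic words; there the lengths of the images of \<open>x\<close> and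
    \<open>y\<close> may be reduced modulo the period. The other eight are avoided by images of a squarefree
    ternary word (the fixed point of Leech's morphism) under four uniform morphisms. In these
    images squares are short and, where the pattern requires it, so are near-squares \<open>u v u\<close> with
    \<open>v\<close> of bounded length and factors whose reversal also occurs; hence \<open>x\<close> and \<open>y\<close> are bounded in
    every instance.\<close>

section \<open>Instances and equivalence of patterns\<close>

fun img :: "'a list \<Rightarrow> 'a list \<Rightarrow> letter \<Rightarrow> 'a list" where
  "img x y X = x"
| "img x y XR = rev x"
| "img x y Y = y"
| "img x y YR = rev y"

definition inst :: "'a list \<Rightarrow> 'a list \<Rightarrow> letter list \<Rightarrow> 'a list" where
  "inst x y p = concat (map (img x y) p)"

lemma inst_Nil [simp]: "inst x y [] = []"
  and inst_Cons [simp]: "inst x y (a # p) = img x y a @ inst x y p"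
  and inst_append [simp]: "inst x y (p @ q) = inst x y p @ inst x y q"
  by (simp_all add: inst_def)

definition contains :: "nat \<Rightarrow> letter list \<Rightarrow> nat list \<Rightarrow> bool" where
  "contains k p w \<longleftrightarrow>
    (\<exists>x y. x \<in> lists {..<k} \<and> y \<in> lists {..<k} \<and> x \<noteq> [] \<and> y \<noteq> [] \<and> sublist (inst x y p) w)"

text \<open>A morphism is determined by its values on letters, and respect for reversal expresses
  those on \<open>XR\<close> and \<open>YR\<close> through those on \<open>X\<close> and
  \<open>Y\<close>. An instance thus amounts to a choice of two nonempty words.\<close>

lemma morphism_eq_inst:
  assumes "morphism k f" "respects_reversal f"
  shows "f p = inst (f [X]) (f [Y]) p"
proof (induction p)
  case Nil
  have "f ([] @ []) = f [] @ f []"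
    using assms(1) unfolding morphism_def by blast
  then show ?case by simp
next
  case (Cons a p)
  have "f ([a] @ p) = f [a] @ f p"
    using assms(1) unfolding morphism_def by blast
  moreover have "f [a] = img (f [X]) (f [Y]) a"
    using assms(2) by (cases a) (simp_all add: respects_reversal_def)
  ultimately show ?case using Cons.IH by simp
qed

lemma is_instance_iff:
  "is_instance k p v \<longleftrightarrow>
    (\<exists>x y. x \<in> lists {..<k} \<and> y \<in> lists {..<k} \<and> x \<noteq> [] \<and> y \<noteq> [] \<and> v = inst x y p)"
proof
  assume "is_instance k p v"
  then obtain f where f: "morphism k f" "nonerasing f" "respects_reversal f" "v = f p"
    unfolding is_instance_def by blast
  then have "f [X] \<in> lists {..<k}" "f [Y] \<in> lists {..<k}" "f [X] \<noteq> []" "f [Y] \<noteq> []"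
    unfolding morphism_def nonerasing_def by blast+
  with f show "\<exists>x y. x \<in> lists {..<k} \<and> y \<in> lists {..<k} \<and> x \<noteq> [] \<and> y \<noteq> [] \<and> v = inst x y p"
    using morphism_eq_inst by blast
next
  assume "\<exists>x y. x \<in> lists {..<k} \<and> y \<in> lists {..<k} \<and> x \<noteq> [] \<and> y \<noteq> [] \<and> v = inst x y p"
  then obtain x y where xy: "x \<in> lists {..<k}" "y \<in> lists {..<k}" "x \<noteq> []" "y \<noteq> []"
    and v: "v = inst x y p" by blast
  have img: "img x y a \<in> lists {..<k} \<and> img x y a \<noteq> []" for a
    using xy by (cases a) (auto simp: in_lists_conv_set)
  then have "inst x y q \<in> lists {..<k}" for q
    by (induction q) auto
  with img have "morphism k (inst x y)" "nonerasing (inst x y)" "respects_reversal (inst x y)"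
    by (auto simp: morphism_def nonerasing_def respects_reversal_def)
  with v show "is_instance k p v" unfolding is_instance_def by blast
qed

lemma avoidable_iff:
  "avoidable k p \<longleftrightarrow> (\<forall>n. \<exists>w \<in> lists {..<k}. n \<le> length w \<and> \<not> contains k p w)"
proof -
  have "avoids k w p \<longleftrightarrow> \<not> contains k p w" for w
    unfolding avoids_def contains_def is_instance_iff by blast
  then show ?thesis unfolding avoidable_def by simp
qed

lemma contains_sublist:
  assumes "contains k p w" "sublist u p"
  shows "contains k u w"
proof -
  obtain ps ss where "p = ps @ u @ ss" using assms(2) unfolding sublist_def by blast
  then have "sublist (inst x y u) (inst x y p)" for x y :: "nat list"
    by (simp add: sublist_appendI)
  with assms(1) show ?thesis
    unfolding contains_def using sublist_order.order_trans by blast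
qed

lemma avoidable_sublist: "avoidable k u \<Longrightarrow> sublist u p \<Longrightarrow> avoidable k p"
  unfolding avoidable_iff using contains_sublist by metis

section \<open>Symmetries of patterns and their effect on avoidability\<close>

lemma inst_iota1: "inst x y (iota1 p) = inst (rev x) y p"
proof (induction p)
  case (Cons a p)
  then show ?case by (cases a) (simp_all add: iota1_def)
qed (simp add: iota1_def)

lemma inst_iota2: "inst x y (iota2 p) = inst y x p"
proof (induction p)
  case (Cons a p)
  then show ?case by (cases a) (simp_all add: iota2_def)
qed (simp add: iota2_def)

text \<open>Reversing an image reverses the order of the blocks and also each block; substituting
  \<open>rev x\<close> and \<open>rev y\<close> undoes the latter.\<close>

lemma inst_iota3: "inst x y (iota3 p) = rev (inst (rev x) (rev y) p)"
proof (induction p)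
  case (Cons a p)
  then show ?case by (cases a) (simp_all add: iota3_def)
qed (simp add: iota3_def)

lemma contains_iota1: "contains k (iota1 p) w \<Longrightarrow> contains k p w"
  unfolding contains_def inst_iota1
  by (metis in_lists_conv_set rev_is_Nil_conv set_rev)

lemma contains_iota2: "contains k (iota2 p) w \<Longrightarrow> contains k p w"
  unfolding contains_def inst_iota2 by blast

lemma contains_iota3: "contains k (iota3 p) w \<Longrightarrow> contains k p (rev w)"
  unfolding contains_def inst_iota3
  by (metis in_lists_conv_set rev_is_Nil_conv set_rev rev_rev_ident sublist_rev)

text \<open>A word avoiding \<open>p\<close> also avoids \<open>iota1 p\<close> and
  \<open>iota2 p\<close>, while its reversal avoids \<open>iota3 p\<close>; the length is
  kept.\<close>

lemma avoidable_iota_step: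
  assumes "avoidable k p" "iota_step p q"
  shows "avoidable k q"
proof -
  have key: "\<exists>w' \<in> lists {..<k}. length w' = length w \<and> \<not> contains k q w'"
    if w: "w \<in> lists {..<k}" "\<not> contains k p w" for w
  proof -
    have "\<not> contains k q w \<or> \<not> contains k q (rev w)"
      using assms(2) w(2) contains_iota1[of k p w] contains_iota2[of k p w] contains_iota3[of k p "rev w"]
      unfolding iota_step_def by auto
    moreover have "rev w \<in> lists {..<k}" using w(1) by (simp add: in_lists_conv_set)
    ultimately show ?thesis using w(1) by (metis length_rev)
  qed
  show ?thesis unfolding avoidable_iff
  proof
    fix n
    obtain w where "w \<in> lists {..<k}" "n \<le> length w" "\<not> contains k p w"
      using assms(1) unfolding avoidable_iff by blast
    with key[of w] show "\<exists>w \<in> lists {..<k}. n \<le> length w \<and> \<not> contains k q w" by metis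
  qed
qed

lemma iota_involutions [simp]: "iota1 (iota1 p) = p" "iota2 (iota2 p) = p" "iota3 (iota3 p) = p"
proof -
  have "flip_x (flip_x a) = a" "swap_xy (swap_xy a) = a" for a by (cases a; simp)+
  then show "iota1 (iota1 p) = p" "iota2 (iota2 p) = p" "iota3 (iota3 p) = p"
    by (simp_all add: iota1_def iota2_def iota3_def o_def)
qed

lemma pattern_equiv_avoidable: "pattern_equiv p q \<Longrightarrow> avoidable k p \<Longrightarrow> avoidable k q"
  unfolding pattern_equiv_def by (induction rule: rtranclp_induct) (auto dest: avoidable_iota_step)

lemma pattern_equiv_refl [simp]: "pattern_equiv p p"
  and pattern_equiv_trans: "pattern_equiv p q \<Longrightarrow> pattern_equiv q r \<Longrightarrow> pattern_equiv p r"
  by (simp_all add: pattern_equiv_def)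

lemma pattern_equiv_iota:
  "pattern_equiv p (iota1 p)" "pattern_equiv p (iota2 p)" "pattern_equiv p (iota3 p)"
  unfolding pattern_equiv_def by (auto simp: iota_step_def intro!: r_into_rtranclp)

lemma pattern_equiv_sym: "pattern_equiv p q \<Longrightarrow> pattern_equiv q p"
proof -
  have "symp iota_step" by (rule sympI) (auto simp: iota_step_def)
  then show "pattern_equiv p q \<Longrightarrow> pattern_equiv q p"
    unfolding pattern_equiv_def by (simp add: symp_rtranclp sympD)
qed

lemma pattern_equiv_length: "pattern_equiv p q \<Longrightarrow> length q = length p"
  unfolding pattern_equiv_def
  by (induction rule: rtranclp_induct) (auto simp: iota_step_def iota1_def iota2_def iota3_def)

text \<open>The lexicographic order on all patterns is not well-founded (\<open>Y\<close>,
  \<open>XY\<close>, \<open>XXY\<close>, ... descends). That \<open>LEAST\<close> is attained comes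
  from the finiteness of the class, whose members share one length.\<close>

lemma pattern_equiv_ell: "pattern_equiv p (ell p)"
proof -
  have "a \<in> {X, XR, Y, YR}" for a by (cases a) simp_all
  then have "finite (UNIV :: letter set)"
    using finite_subset[of UNIV "{X, XR, Y, YR}"] by blast
  then have "finite {q :: letter list. set q \<subseteq> UNIV \<and> length q = length p}"
    by (rule finite_lists_length_eq)
  then have fin: "finite {q. pattern_equiv p q}"
    by (rule rev_finite_subset) (auto dest: pattern_equiv_length)
  have "ell p = Min {q. pattern_equiv p q}"
    unfolding ell_def by (rule Least_Min[OF fin]) (rule exI[of _ p], simp)
  then show ?thesis using Min_in[OF fin] pattern_equiv_refl[of p] by (metis empty_iff mem_Collect_eq)
qed

lemma ell_cong: "pattern_equiv p q \<Longrightarrow> ell p = ell q"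
proof -
  assume "pattern_equiv p q"
  then have "pattern_equiv p = pattern_equiv q"
    using pattern_equiv_sym pattern_equiv_trans by blast
  then show "ell p = ell q" unfolding ell_def by simp
qed

lemma avoidable_ell: "avoidable k (ell p) \<longleftrightarrow> avoidable k p"
  using pattern_equiv_ell pattern_equiv_sym pattern_equiv_avoidable by blast

definition S2_words :: "letter list list" where
  "S2_words = [
    [X, X, X], [X, X, Y, X, YR], [X, X, Y, XR, Y], [X, X, Y, X, Y, Y], [X, X, Y, XR, YR],
    [X, X, Y, Y, X], [X, X, Y, Y, XR], [X, XR], [X, Y, X, X, Y], [X, Y, XR, XR, Y],
    [X, Y, X, Y, X], [X, Y, X, Y, XR], [X, Y, XR, Y, X], [X, Y, XR, YR, X], [X, Y, Y, XR],
    [X, Y, X, YR, X], [X, Y, X, YR, XR]]"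

lemma S2_eq: "S2 = set S2_words"
  by (simp add: S2_def S2_words_def)

section \<open>Patterns without factors in S2\<close>

text \<open>\<open>iota1\<close> and \<open>iota2\<close> generate a dihedral group of order 8, each
  element of which is an alternating product of at most four factors; \<open>iota3\<close> commutes
  with both. The list has repetitions.\<close>

fun orbit :: "letter list \<Rightarrow> letter list list" where
  "orbit p =
    (let f = (\<lambda>qs. qs @ map iota1 qs); s = (\<lambda>qs. qs @ map iota2 qs)
     in (\<lambda>qs. qs @ map iota3 qs) (s (f (s (f [p])))))"

fun closed_least :: "letter list list \<Rightarrow> letter list \<Rightarrow> bool" where
  "closed_least qs p \<longleftrightarrow> list_all (\<lambda>q. p \<le> q \<and> List.member qs (iota1 q) \<and>
     List.member qs (iota2 q) \<and> List.member qs (iota3 q)) qs"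

lemma S2_closed_least: "list_all (\<lambda>s. closed_least (orbit s) s) S2_words"
  by code_simp

text \<open>A list that contains \<open>s\<close> and is closed under the three generators contains
  the whole class, so minimality within the list is minimality within the class.\<close>

lemma ell_S2:
  assumes "s \<in> S2"
  shows "ell s = s"
proof -
  have c: "closed_least (orbit s) s"
    using assms S2_closed_least unfolding S2_eq list_all_iff by blast
  have "q \<in> set (orbit s)" if "pattern_equiv s q" for q
    using that[unfolded pattern_equiv_def]
  proof (induction rule: rtranclp_induct)
    case base
    show ?case by (simp add: Let_def)
  next
    case (step q r)
    with c show ?case by (auto simp: list_all_iff iota_step_def simp del: orbit.simps)
  qed
  with c have "s \<le> q" if "pattern_equiv s q" for q
    using that by (auto simp: list_all_iff simp del: orbit.simps)
  then show ?thesis unfolding ell_def by (intro Least_equality) simp_all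
qed

text \<open>A cheap normal form under \<open>iota1\<close> and \<open>iota2\<close> only: the first
  letter becomes \<open>X\<close> and the first letter among \<open>Y\<close>, \<open>YR\<close>
  becomes \<open>Y\<close>. The composition \<open>iota2 (iota1 (iota2 r))\<close> exchanges
  \<open>Y\<close> with \<open>YR\<close>. Reversal of the order is left to the callers.\<close>

definition canon :: "letter list \<Rightarrow> letter list" where
  "canon p =
    (let q = (if list_ex (\<lambda>a. a = Y \<or> a = YR) (take 1 p) then iota2 p else p);
         r = (if List.member (take 1 q) XR then iota1 q else q)
     in if List.member (take 1 (filter (\<lambda>a. a = Y \<or> a = YR) r)) YR
        then iota2 (iota1 (iota2 r)) else r)"

lemma pattern_equiv_canon: "pattern_equiv p (canon p)"
proof -
  have "pattern_equiv p (iota1 q)" "pattern_equiv p (iota2 q)" if "pattern_equiv p q" for q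
    using that pattern_equiv_iota(1,2) pattern_equiv_trans by blast+
  then show ?thesis unfolding canon_def Let_def by (simp split: if_split)
qed

text \<open>A computable sufficient criterion for \<open>ell u \<in> S2\<close>. One direction is
  enough, since a weaker filter can only enlarge \<open>S2_free\<close>.\<close>

definition S2_like :: "letter list \<Rightarrow> bool" where
  "S2_like u \<longleftrightarrow> List.member S2_words (canon u) \<or> List.member S2_words (canon (rev u))"

lemma S2_like_ell:
  assumes "S2_like u"
  shows "ell u \<in> S2"
proof -
  have "pattern_equiv u (canon (rev u))"
    using pattern_equiv_iota(3)[of u] pattern_equiv_canon[of "rev u"] pattern_equiv_trans
    unfolding iota3_def by blast
  then have "\<exists>s \<in> S2. pattern_equiv u s"
    using assms pattern_equiv_canon[of u] unfolding S2_like_def S2_eq by auto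
  then show ?thesis using ell_cong ell_S2 by metis
qed

definition left_extensions :: "letter list \<Rightarrow> letter list list" where
  "left_extensions p = [X # p, XR # p, Y # p, YR # p]"

text \<open>Factors not starting at the new first letter were tested at an earlier length, so only
  prefixes are examined.\<close>

fun S2_free :: "nat \<Rightarrow> letter list list" where
  "S2_free 0 = [[]]"
| "S2_free (Suc n) =
    filter (\<lambda>p. \<not> list_ex S2_like (prefixes p)) (concat (map left_extensions (S2_free n)))"

lemma S2_free_complete:
  assumes "\<And>u. sublist u p \<Longrightarrow> ell u \<notin> S2"
  shows "p \<in> set (S2_free (length p))"
  using assms
proof (induction p)
  case (Cons a p)
  have "p \<in> set (S2_free (length p))"
    using Cons.prems by (intro Cons.IH) (auto simp: sublist_Cons_right)
  moreover have "a # p \<in> set (left_extensions p)"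
    by (cases a) (simp_all add: left_extensions_def)
  moreover have "\<not> list_ex S2_like (prefixes (a # p))"
    using Cons.prems S2_like_ell prefix_imp_sublist unfolding list_ex_iff by (metis in_set_prefixes)
  ultimately show ?case by auto
qed simp

text \<open>As \<open>canon\<close> does not reverse the order, the list has
  \<open>[X,Y,XR,Y]\<close> besides \<open>[X,Y,X,YR]\<close> and \<open>[Y,X,Y,X,X]\<close> besides
  \<open>[X,X,Y,X,Y]\<close>, although these are equivalent in pairs.\<close>

definition max_unavoidable :: "letter list list" where
  "max_unavoidable = [[X,Y,Y,X], [X,Y,XR,YR], [X,Y,X,YR], [X,Y,XR,Y], [X,X,Y,Y],
    [X,X,Y,X,X], [X,X,Y,XR,XR], [X,X,Y,X,Y], [Y,X,Y,X,X]]"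

lemma S2_free_6: "S2_free 6 = []"
  by code_simp

lemma S2_free_max_unavoidable:
  "list_all (List.member (concat (map (map canon \<circ> sublists) max_unavoidable)))
    (map canon (concat (map S2_free [0..<6])))"
  by code_simp

text \<open>Each list is built from the preceding one, so emptiness at length 6 persists.\<close>

lemma S2_free_less_6: "p \<in> set (S2_free n) \<Longrightarrow> n < 6"
proof (rule ccontr)
  assume p: "p \<in> set (S2_free n)" and "\<not> n < 6"
  have "S2_free (6 + m) = []" for m
  proof (induction m)
    case 0
    show ?case by (simp only: add_0_right S2_free_6)
  next
    case (Suc m)
    then show ?case by (simp only: add_Suc_right S2_free.simps list.map concat.simps filter.simps)
  qed
  then have "S2_free n = []" using \<open>\<not> n < 6\<close> by (metis le_add_diff_inverse not_less)
  with p show False by simp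
qed

lemma S2_or_sublist_max:
  assumes "\<And>u. sublist u p \<Longrightarrow> ell u \<notin> S2"
  obtains q f where "q \<in> set max_unavoidable" "sublist f q" "pattern_equiv p f"
proof -
  have p: "p \<in> set (S2_free (length p))" by (rule S2_free_complete[OF assms])
  with S2_free_less_6 have "p \<in> set (concat (map S2_free [0..<6]))" by auto
  then have "canon p \<in> set (map canon (concat (map S2_free [0..<6])))"
    unfolding set_map by (rule imageI)
  then have "canon p \<in> set (concat (map (map canon \<circ> sublists) max_unavoidable))"
    using S2_free_max_unavoidable by (auto simp: list_all_iff simp del: set_concat set_map)
  then obtain q f where q: "q \<in> set max_unavoidable" "sublist f q" "canon p = canon f"
    by auto
  with pattern_equiv_canon pattern_equiv_sym pattern_equiv_trans have "pattern_equiv p f" by metis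
  with q(1,2) show thesis by (rule that)
qed

section \<open>Unavoidable patterns\<close>

text \<open>Long contexts are demanded on both sides because derivations extend words in either
  direction.\<close>

definition forces :: "letter list \<Rightarrow> nat list \<Rightarrow> bool" where
  "forces p u \<longleftrightarrow> (\<exists>N. \<forall>a b. N \<le> length a \<longrightarrow> N \<le> length b \<longrightarrow>
     a @ u @ b \<in> lists {..<2} \<longrightarrow> contains 2 p (a @ u @ b))"

lemma forces_inst:
  assumes "x \<in> lists {..<2}" "y \<in> lists {..<2}" "x \<noteq> []" "y \<noteq> []"
  shows "forces p (inst x y p)"
  using assms unfolding forces_def contains_def by blast

lemma forces_sublist:
  assumes "forces p u"
  shows "forces p (a @ u @ b)"
proof -
  obtain N where N: "\<And>a b. N \<le> length a \<Longrightarrow> N \<le> length b \<Longrightarrow> a @ u @ b \<in> lists {..<2} \<Longrightarrow>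
      contains 2 p (a @ u @ b)"
    using assms unfolding forces_def by blast
  have "contains 2 p (c @ (a @ u @ b) @ d)"
    if "N \<le> length c" "N \<le> length d" "c @ (a @ u @ b) @ d \<in> lists {..<2}" for c d
    using that N[of "c @ a" "b @ d"] by simp
  then show ?thesis unfolding forces_def by blast
qed

lemma forces_right:
  assumes "forces p (u @ [0])" "forces p (u @ [1])"
  shows "forces p u"
proof -
  have "\<exists>N. \<forall>c \<in> {0, 1}. \<forall>a b. N \<le> length a \<longrightarrow> N \<le> length b \<longrightarrow>
      a @ (u @ [c]) @ b \<in> lists {..<2} \<longrightarrow> contains 2 p (a @ (u @ [c]) @ b)"
  proof -
    obtain N0 N1 where
      "\<forall>a b. N0 \<le> length a \<longrightarrow> N0 \<le> length b \<longrightarrow>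
        a @ (u @ [0]) @ b \<in> lists {..<2} \<longrightarrow> contains 2 p (a @ (u @ [0]) @ b)"
      "\<forall>a b. N1 \<le> length a \<longrightarrow> N1 \<le> length b \<longrightarrow>
        a @ (u @ [1]) @ b \<in> lists {..<2} \<longrightarrow> contains 2 p (a @ (u @ [1]) @ b)"
      using assms unfolding forces_def by blast
    then show ?thesis by (intro exI[of _ "max N0 N1"]) simp
  qed
  then obtain N where N: "\<And>c a b. c \<in> {0, 1} \<Longrightarrow> N \<le> length a \<Longrightarrow> N \<le> length b \<Longrightarrow>
      a @ (u @ [c]) @ b \<in> lists {..<2} \<Longrightarrow> contains 2 p (a @ (u @ [c]) @ b)"
    by blast
  have "contains 2 p (a @ u @ b)"
    if ab: "Suc N \<le> length a" "Suc N \<le> length b" "a @ u @ b \<in> lists {..<2}" for a b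
  proof -
    \<comment> \<open>The bound \<open>Suc N\<close> provides a letter after \<open>u\<close>; once
      it has joined the forced word, \<open>N\<close> letters still remain on the right.\<close>
    obtain c b' where b: "b = c # b'" using ab(2) by (cases b) auto
    with ab(3) have "c \<in> {0, 1}" by auto
    with N[of c a b'] ab b show ?thesis by simp
  qed
  then show ?thesis unfolding forces_def by blast
qed

section \<open>Reversal and complementation of forced words\<close>

lemma contains_rev:
  assumes "contains k p w"
  shows "contains k (rev p) (rev w)"
proof -
  have "iota3 (rev p) = p" by (simp add: iota3_def)
  with assms show ?thesis using contains_iota3[of k "rev p" w] by simp
qed

lemma forces_rev:
  assumes "forces p u"
  shows "forces (rev p) (rev u)"
proof -
  obtain N where N: "\<And>a b. N \<le> length a \<Longrightarrow> N \<le> length b \<Longrightarrow> a @ u @ b \<in> lists {..<2} \<Longrightarrow>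
      contains 2 p (a @ u @ b)"
    using assms unfolding forces_def by blast
  have "contains 2 (rev p) (a @ rev u @ b)"
    if "N \<le> length a" "N \<le> length b" "a @ rev u @ b \<in> lists {..<2}" for a b
    using contains_rev[OF N[of "rev b" "rev a"]] that by (auto simp: in_lists_conv_set ball_Un)
  then show ?thesis unfolding forces_def by blast
qed

text \<open>The mirror image of \<open>forces_right\<close>, obtained by reversing pattern and word
  together.\<close>

lemma forces_left:
  assumes "forces p (0 # u)" "forces p (1 # u)"
  shows "forces p u"
  using forces_rev[OF forces_right[of "rev p" "rev u"]]
    forces_rev[OF assms(1)] forces_rev[OF assms(2)] by simp

text \<open>Complementation of bits, continued by the identity so that it is an involution on all of
  \<open>nat\<close>.\<close>

definition flip :: "nat \<Rightarrow> nat" where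
  "flip a = (if a = 0 then 1 else if a = 1 then 0 else a)"

lemma flip_flip [simp]: "flip (flip a) = a" "flip \<circ> flip = id"
  by (auto simp: flip_def)

lemma flip_less_2 [simp]: "flip a < 2 \<longleftrightarrow> a < 2"
  by (auto simp: flip_def)

lemma inst_map: "inst (map f x) (map f y) p = map f (inst x y p)"
proof (induction p)
  case (Cons a p)
  then show ?case by (cases a) (simp_all add: rev_map)
qed simp

lemma contains_map_flip:
  assumes "contains 2 p w"
  shows "contains 2 p (map flip w)"
proof -
  obtain x y where "x \<in> lists {..<2}" "y \<in> lists {..<2}" "x \<noteq> []" "y \<noteq> []"
    "sublist (inst x y p) w"
    using assms unfolding contains_def by blast
  then have "map flip x \<in> lists {..<2}" "map flip y \<in> lists {..<2}"
    "map flip x \<noteq> []" "map flip y \<noteq> []" "sublist (inst (map flip x) (map flip y) p) (map flip w)"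
    by (auto simp: inst_map in_lists_conv_set intro: map_mono_sublist)
  then show ?thesis unfolding contains_def by blast
qed

lemma forces_flip:
  assumes "forces p u"
  shows "forces p (map flip u)"
proof -
  obtain N where N: "\<And>a b. N \<le> length a \<Longrightarrow> N \<le> length b \<Longrightarrow> a @ u @ b \<in> lists {..<2} \<Longrightarrow>
      contains 2 p (a @ u @ b)"
    using assms unfolding forces_def by blast
  have "contains 2 p (a @ map flip u @ b)"
    if "N \<le> length a" "N \<le> length b" "a @ map flip u @ b \<in> lists {..<2}" for a b
    using contains_map_flip[OF N[of "map flip a" "map flip b"]] that
    by (auto simp: in_lists_conv_set ball_Un)
  then show ?thesis unfolding forces_def by blast
qed

text \<open>A derivation adds a word \<open>u\<close> to the list of forced words when both left extensions of \<open>u\<close> begin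
  with words of the list or both right extensions end with words of the list. The list is closed
  under complementation, and \<open>rs\<close> holds its reversals.\<close>

fun has_prefix :: "nat list list \<Rightarrow> nat list \<Rightarrow> bool" where
  "has_prefix [] v = False"
| "has_prefix (d # ds) v \<longleftrightarrow> prefix d v \<or> has_prefix ds v"

fun derivation :: "nat list list \<Rightarrow> nat list list \<Rightarrow> nat list list \<Rightarrow> bool" where
  "derivation ds rs [] \<longleftrightarrow> List.member ds []"
| "derivation ds rs (u # us) \<longleftrightarrow>
    (has_prefix ds (0 # u) \<and> has_prefix ds (1 # u) \<or>
     has_prefix rs (0 # rev u) \<and> has_prefix rs (1 # rev u)) \<and>
    derivation (u # map flip u # ds) (rev u # map flip (rev u) # rs) us"

lemma has_prefix_forces:
  assumes "has_prefix ds v" "\<And>d. d \<in> set ds \<Longrightarrow> forces p d"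
  shows "forces p v"
  using assms
proof (induction ds)
  case (Cons d ds)
  then show ?case using forces_sublist[of p d "[]"] by (auto simp: prefix_def)
qed simp

lemma derivation_forces:
  assumes "derivation ds (map rev ds) us" "\<And>d. d \<in> set ds \<Longrightarrow> forces p d"
  shows "forces p []"
  using assms
proof (induction us arbitrary: ds)
  case Nil
  then show ?case by simp
next
  case (Cons u us)
  have rs: "forces (rev p) d" if "d \<in> set (map rev ds)" for d
    using that Cons.prems(2) forces_rev by auto
  have "forces p u"
  proof (cases "has_prefix ds (0 # u) \<and> has_prefix ds (1 # u)")
    case True
    with Cons.prems(2) show ?thesis by (meson forces_left has_prefix_forces)
  next
    case False
    with Cons.prems(1) have "has_prefix (map rev ds) (0 # rev u)" "has_prefix (map rev ds) (1 # rev u)"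
      by auto
    \<comment> \<open>The left extensions of \<open>rev u\<close> are the reversed right extensions
      of \<open>u\<close>, and the reversed list is forced for the reversed pattern.\<close>
    with rs have "forces (rev p) (rev u)" by (meson forces_left has_prefix_forces)
    then show ?thesis using forces_rev by fastforce
  qed
  then have "d \<in> set (u # map flip u # ds) \<Longrightarrow> forces p d" for d
    using Cons.prems(2) forces_flip by auto
  moreover have "derivation (u # map flip u # ds) (map rev (u # map flip u # ds)) us"
    using Cons.prems(1) by (simp add: rev_map)
  ultimately show ?case by (rule Cons.IH[rotated])
qed

text \<open>The starting list of a derivation: chosen instances, together with their complements so
  that it is closed under \<open>flip\<close>.\<close>

fun seeds :: "letter list \<Rightarrow> (nat list \<times> nat list) list \<Rightarrow> nat list list" where
  "seeds p [] = []"
| "seeds p ((x, y) # xys) = inst x y p # map flip (inst x y p) # seeds p xys"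

fun binary_words :: "(nat list \<times> nat list) list \<Rightarrow> bool" where
  "binary_words [] = True"
| "binary_words ((x, y) # xys) \<longleftrightarrow> x \<noteq> [] \<and> y \<noteq> [] \<and> list_all ((\<ge>) 1) x \<and>
     list_all ((\<ge>) 1) y \<and> binary_words xys"

definition refutes :: "letter list \<Rightarrow> (nat list \<times> nat list) list \<Rightarrow> nat list list \<Rightarrow> bool" where
  "refutes p xys us \<longleftrightarrow>
    binary_words xys \<and> derivation (seeds p xys) (map rev (seeds p xys)) us"

lemma refutes_not_avoidable:
  assumes "refutes p xys us"
  shows "\<not> avoidable 2 p"
proof -
  have "d \<in> set (seeds p xys) \<Longrightarrow> binary_words xys \<Longrightarrow> forces p d" for d
  proof (induction xys)
    case (Cons xy xys)
    obtain x y where xy: "xy = (x, y)" by fastforce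
    then have "x \<in> lists {..<2}" "y \<in> lists {..<2}" "x \<noteq> []" "y \<noteq> []"
      using Cons.prems(2) by (auto simp: list_all_iff in_lists_conv_set dest: bspec)
    then have "forces p (inst x y p)" by (rule forces_inst)
    with Cons xy forces_flip show ?case by auto
  qed simp
  then have "forces p []"
    using assms derivation_forces unfolding refutes_def by blast
  then obtain N where N: "\<And>a b. N \<le> length a \<Longrightarrow> N \<le> length b \<Longrightarrow> a @ b \<in> lists {..<2} \<Longrightarrow>
      contains 2 p (a @ b)"
    unfolding forces_def append_Nil by blast
  \<comment> \<open>The word is cut after \<open>N\<close> letters, with the forced empty word at
    the cut.\<close>
  have "contains 2 p w" if w: "w \<in> lists {..<2}" "2 * N \<le> length w" for w
    using N[of "take N w" "drop N w"] w by (simp del: append_in_lists_conv)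
  then show ?thesis unfolding avoidable_iff by (meson order_refl)
qed

section \<open>Certificates for seven unavoidable patterns\<close>

text \<open>In this and the following certificates the pairs \<open>(x, y)\<close> yield the initial
  instances. The second list gives the further forced words in order of derivation, one from each
  complementary pair, down to the empty word.\<close>

lemma not_avoidable_xyyx: "\<not> avoidable 2 [X, Y, Y, X]"
proof -
  have "refutes [X, Y, Y, X] [([0], [0]), ([0], [1,0]), ([0,1], [1]), ([0,1], [0,1]), ([0], [1]),
    ([0,0,0,1], [1])] [[0,0,1,1,1,0,0,0,1], [0,1,0,1,0,1,0], [0,0,0,1,0], [0,0,1,0], [0,1,0,1,0,1],
    [0,1,0,1,0], [0,1,0,1], [0,1,0], [0,1,1,1,0,0,0,1], [0,1,1,1,0,0,0], [0,1,1,1,0,0], [0,0,0,1,1],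
    [0,0,1,1], [0,1,1], [0,0,0], [0,1], [0,0], [0], []]"
    by code_simp
  then show ?thesis by (rule refutes_not_avoidable)
qed

lemma not_avoidable_xyxryr: "\<not> avoidable 2 [X, Y, XR, YR]"
proof -
  have "refutes [X, Y, XR, YR] [([0], [1,1]), ([0], [0]), ([0,1], [1]), ([0], [1,1,1,0]), ([0], [1,1,0]),
    ([0], [1]), ([0,0], [1,1])] [[0,0,0,1,1,1,0,0,0], [0,1,1,0,0,0,1], [0,1,1,0,0,0], [0,0,0,1,0],
    [0,1,1,0,1], [0,0,1,0], [0,1,0], [0,1,1,0,0,1,1], [0,1,1,0,0,1], [0,1,1,0,0], [0,1,1,0],
    [0,0,1,1,1,0,0,0], [0,1,1,1,0,0,0], [0,0,0,1,1,1], [0,0,1,1,1], [0,1,1,1], [0,0,0], [0,1,1],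
    [0,1], [0,0], [0], []]"
    by code_simp
  then show ?thesis by (rule refutes_not_avoidable)
qed

lemma not_avoidable_xyxyr: "\<not> avoidable 2 [X, Y, X, YR]"
proof -
  have "refutes [X, Y, X, YR] [([0], [0]), ([0,0], [1]), ([0], [1,0]), ([0], [1,1,1,0]), ([0], [1,1,0]),
    ([0], [1]), ([0,0], [1,1])] [[0,1,0,0,0], [0,0,1,0,0], [0,0,1,0], [0,1,0], [0,1,1,0,0,1,1],
    [0,1,1,0,0,1], [0,1,1,0,0,0,1], [0,1,1,0,0,0], [0,1,1,0,0], [0,1,1,0], [0,1,1,1,0,0,0,1,1],
    [0,1,1,1,0,0,0,1], [0,0,0,1,1,1,0], [0,0,0,1,1,1], [0,0,1,1,1], [0,1,1,1], [0,0,0], [0,0,1],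
    [0,1], [0,0], [0], []]"
    by code_simp
  then show ?thesis by (rule refutes_not_avoidable)
qed

lemma not_avoidable_xxyy: "\<not> avoidable 2 [X, X, Y, Y]"
proof -
  have "refutes [X, X, Y, Y] [([0], [0]), ([0,1], [0]), ([0,1], [1]), ([0,1], [0,1]), ([0], [1]), ([0],
    [1,0,0]), ([0], [1,0,1]), ([0], [0,1,0,0])] [[0,0,1,0,1,1,0], [0,1,0,1,0,1,0], [0,1,0,1,0,1],
    [0,1,0,1,0], [0,1,0,1,1,0], [0,1,0,0,1,0,0], [0,1,0,1,1], [0,1,0,1], [0,1,0,0,1,0], [0,1,1,0,1],
    [0,0,1,0,0,0,1,0,0], [0,0,1,0,0,0,1,0], [0,1,0,0,0,1,0], [0,1,0,0,0,1], [0,1,0,0,0], [0,1,1,0],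
    [0,1,0,0], [0,1,0], [0,0,1], [0,0,0], [0,1], [0,0], [0], []]"
    by code_simp
  then show ?thesis by (rule refutes_not_avoidable)
qed

lemma not_avoidable_xxyxx: "\<not> avoidable 2 [X, X, Y, X, X]"
proof -
  have "refutes [X, X, Y, X, X] [([0], [1,0,1,1]), ([0], [1]), ([0], [1,1,1]), ([0,1], [1,1,1]), ([0,1],
    [1]), ([0], [1,1,1,0,1,0,1]), ([0,1], [0,1]), ([0], [1,0,1]), ([0], [1,0,1,0,1,1]), ([0,1],
    [1,1,1,0]), ([0], [1,1,1,0,1,0,1,0,1]), ([0], [0]), ([0], [1,0,1,0,1,0,1]), ([0],
    [1,0,1,0,1,0,1,1,1]), ([0], [1,1,1,1,0,1,0,1]), ([0], [1,0,1,1,1,1,0,1]), ([0], [1,0,1,1,1,0,1]),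
    ([0], [1,1,1,1]), ([0,1], [1,1,0]), ([0], [1,0,1,0,1]), ([0,1], [0,0]), ([0,1], [0,0,0]), ([0],
    [1,0,1,1,0,1]), ([0,1], [1,1]), ([0], [1,0,1,0,1,0,1,1]), ([0], [1,1]), ([0], [1,0,1,1,1,1]),
    ([0,1], [0]), ([0], [1,1,1,1,0,1,0,1,0,1]), ([0], [1,0,1,1,1])] [[0,1,0,1,0,1,0,1,0,0],
    [0,1,0,1,0,1,0,1,0], [0,0,1,1,1,1,0,1,0,1,0,1,0], [0,1,0,1,1,1,1,0,1,0,0], [0,1,0,0,0,0,1,0,1,0],
    [0,1,0,1,1,1,1,0,1,0], [0,1,0,0,0,0,1,0,1], [0,1,0,0,0,0,1,0], [0,1,1,1,1,0,1,0,1,0,1,0],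
    [0,1,1,1,1,0,1,0,1,0,1], [0,1,1,1,1,0,1,0,1,0,0], [0,0,0,0,1,0,1,0,1,1], [0,1,0,0,0,1,0,1,0],
    [0,1,1,1,0,1,0,1,0,0], [0,0,0,1,0,1,0,1,1], [0,1,0,0,0,0,1,1,0,1,0], [0,1,1,1,1,0,0,1,0,1],
    [0,1,1,1,1,0,0,1,0], [0,1,0,1,0,0,1,0], [0,0,1,0,1,0,1,0,1,1,0], [0,1,0,1,0,1,0,1,1,0],
    [0,1,0,1,0,1,0,0,1], [0,0,1,0,1,0,1,1,0], [0,1,0,1,0,1,1,0], [0,1,0,1,0,0,1], [0,0,1,0,1,1,0,1,0],
    [0,1,0,1,1,0,1,0], [0,1,0,1,1,0,1], [0,0,1,0,1,1,0], [0,1,0,1,1,0], [0,1,0,0,1], [0,1,1,0,0],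
    [0,1,1,1,1,0,0,1], [0,0,0,0,1,1,0], [0,1,0,1,1,1,0,0,1,0], [0,1,0,1,1,1,0,0,1], [0,1,0,0,0,1,1,0],
    [0,1,1,1,0,0,1], [0,0,0,1,1,0], [0,0,1,1,0], [0,1,1,0], [0,0,1,0,1,0,1,1], [0,1,1,1,1,0,1,0,1,0],
    [0,0,0,0,1,0,1,0,1], [0,0,0,0,1,0,1,0], [0,0,1,1,1,0,1,0,1,0,1,0], [0,0,1,1,1,0,1,0,1,0,1],
    [0,1,0,1,0,0,0,1,0], [0,0,1,0,1,0,1,0,1,1,1,0], [0,1,0,1,0,1,0,1,1,1,0], [0,1,0,1,0,1,0,0,0,1],
    [0,1,0,1,0,1,1,1,0], [0,1,0,1,0,0,0,1], [0,0,1,0,1,1,1,1,0], [0,0,1,0,1,1,1,1],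
    [0,0,1,0,1,1,1,0,1,0], [0,0,1,0,1,1,1,0,1], [0,0,1,0,1,1,1,0], [0,0,1,0,1,1,1], [0,0,1,0,1,1],
    [0,1,0,1,1,1,0], [0,1,0,0,0,1], [0,1,1,1,0,1,0,1,0,1], [0,1,1,1,0,1,0,1,0], [0,1,1,1,0,1,0,1],
    [0,1,1,1,0,1,0], [0,1,1,1,0,1], [0,1,1,1,0,0], [0,1,1,1,0], [0,0,0,1,0,1,0], [0,0,1,0,1,0],
    [0,1,0,1,0,1,0,1], [0,0,1,0,1], [0,0,1,0], [0,0,1,1,1,1,0], [0,0,1,1,1,1], [0,0,1,1,1], [0,0,1,1],
    [0,0,1], [0,0,0,0], [0,0,0], [0,0], [0,1,0,1,0,1,0], [0,1,0,1,0,1], [0,1,0,1,0], [0,1,0,1],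
    [0,1,0], [0,1], [0], []]"
    by code_simp
  then show ?thesis by (rule refutes_not_avoidable)
qed

lemma not_avoidable_xxyxrxr: "\<not> avoidable 2 [X, X, Y, XR, XR]"
proof -
  have "refutes [X, X, Y, XR, XR] [([0], [1]), ([0,1], [1]), ([0], [1,0,1,0,1,1,1,1]), ([0,1], [0]), ([0],
    [1,1,1]), ([0,1], [1,1]), ([0,1], [0,1]), ([0], [1,0,1]), ([0], [1,0,1,0,1,1]), ([0],
    [1,0,1,0,1,1,1]), ([0], [1,1,0,1]), ([0], [1,1,1,0,1]), ([0], [1,1,0,1,0,1,0,1]), ([0],
    [1,1,1,0,1,0,1,0,1]), ([0], [0]), ([0], [1,0,1,0,1,0,1,1,1]), ([0], [1,1,1,1]), ([0],
    [1,0,1,0,1]), ([0], [1,0,1,1,0,1]), ([0], [1,0,1,0,1,0,1,1]), ([0], [1,1]), ([0], [1,1,1,1,0,1]),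
    ([0], [1,1,1,1,0,1,0,1,0,1])] [[0,1,0,0,0,0,1,0,1], [0,1,1,1,1,0,1,0,1,0,1,0,0],
    [0,0,0,0,1,0,1,0,1,0,1,1], [0,0,0,0,1,0,1,0,1,0,1], [0,1,0,0,0,1,0,1], [0,1,0,0,0,1,0],
    [0,0,1,0,1,0,1,0,1,1,1,0], [0,1,0,1,0,1,0,1,1,1,0], [0,1,0,1,0,1,0,0,0,1], [0,1,0,0,0,0,1,0],
    [0,0,1,0,1,0,1,1,1,1,0], [0,0,1,0,1,0,1,1,1,1], [0,0,1,0,1,0,1,1,1,0], [0,0,1,0,1,0,1,1,1],
    [0,1,0,1,0,1,1,0,1], [0,0,1,0,1,0,1,1,0], [0,0,1,0,1,0,1,1], [0,1,0,1,0,1,1,1,0],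
    [0,1,0,1,0,0,0,1], [0,1,0,1,0,0,1,0], [0,1,0,1,1,0,1,0,0], [0,1,0,0,1,0,1,1], [0,1,1,0,1,0,0],
    [0,1,1,1,1,0,1,0,0], [0,0,0,0,1,0,1,1], [0,1,1,1,0,1,0,0], [0,0,0,1,0,1,1], [0,0,1,0,1,1],
    [0,1,0,1,1,1,0], [0,1,0,0,0,1], [0,1,1,1,0,1,0,1,0,1,0,0], [0,1,1,1,0,1,0,1,0,1,0],
    [0,1,1,1,0,1,0,1,0,1], [0,1,1,1,0,1,0,1,0], [0,1,1,1,0,1,0,1], [0,1,1,1,0,1,0], [0,1,1,1,0,1],
    [0,0,1,1,1,0], [0,1,1,1,0], [0,0,0,1,0,1,0,1,0,1], [0,0,0,1,0,1,0,1,0], [0,0,0,1,0,1,0,1],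
    [0,1,0,1,0,1,0,1,1,0,0], [0,1,0,1,0,1,0,0,1,1], [0,0,1,1,0,1,0,1,0,1,0], [0,1,0,1,1,0,1],
    [0,1,0,0,1,0], [0,1,1,0,1,0,1,0,1,0], [0,1,1,0,1,0,1,0,1], [0,1,1,0,1,0,1,0], [0,1,1,0,1,0,1],
    [0,1,1,0,1,0], [0,1,1,0,1], [0,1,0,1,0,1,0,0,1], [0,1,0,1,0,1,1,0], [0,1,0,1,0,0,1],
    [0,1,0,1,1,0], [0,1,0,0,1], [0,0,1,1,0], [0,1,1,0], [0,0,1,0,1,0,1], [0,1,0,1,0,1,0,1],
    [0,0,1,0,1,0], [0,0,1,0,1], [0,0,1,0], [0,0,1,1,1,1,0], [0,0,1,1,1,1], [0,0,1,1,1], [0,0,1,1],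
    [0,0,1], [0,0,0,0], [0,0,0], [0,0], [0,1,0,1,0,1,0], [0,1,0,1,0,1], [0,1,0,1,0], [0,1,0,1],
    [0,1,0], [0,1], [0], []]"
    by code_simp
  then show ?thesis by (rule refutes_not_avoidable)
qed

lemma not_avoidable_xxyxy: "\<not> avoidable 2 [X, X, Y, X, Y]"
proof -
  have "refutes [X, X, Y, X, Y] [([0], [1,1,1,1,0,0]), ([0], [1,0,0,0]), ([0], [1,1]), ([0], [1,0]),
    ([0,1], [0,1]), ([0], [1,0,0]), ([0], [0,1]), ([0], [0]), ([0], [0,0,1]), ([0], [1]), ([0],
    [0,1,1]), ([0], [0,0,1,1]), ([0], [0,1,1,1]), ([0], [1,1,1,1]), ([0], [1,1,0,0]), ([0],
    [1,1,1,1,0]), ([0], [0,0,1,1,1]), ([0], [1,1,1,0,0]), ([0,1], [0,0]), ([0], [1,1,1]), ([0,1],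
    [0]), ([0], [1,1,0]), ([0], [1,1,1,1,0,0,0])] [[0,0,1,1,1,1,0,1,1,1], [0,1,0,1,0,1,0,1,0],
    [0,1,0,1,0,1,0,1], [0,1,0,1,0,1,0], [0,1,0,1,0,1], [0,1,0,1,0], [0,1,0,1], [0,1,0,1,1,0,1],
    [0,1,0,0,1,0], [0,0,1,1,0,1], [0,1,1,0,1], [0,0,1,0,0,1], [0,1,0,0,1], [0,0,1,1,1,1,0,1,1],
    [0,0,1,0,0,0,0,1,0,0], [0,1,0,0,0,0,1,0,0], [0,1,0,0,0,0,1,0], [0,1,1,1,1,0,1,1], [0,1,1,1,1,0,1],
    [0,0,0,0,1,0], [0,1,0,1,1,1,0,1,1], [0,1,0,1,1,1,0,1], [0,0,1,0,0,0,1,0], [0,1,0,0,0,1,0],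
    [0,0,1,1,1,0,1,1], [0,0,1,1,1,0,1], [0,1,1,1,0,1], [0,0,0,1,0], [0,0,1,0], [0,1,0],
    [0,1,1,1,1,0,0,0,0,1,1,1,1,0,0,0], [0,1,1,1,1,0,0,1,1,1,1,0], [0,1,1,1,1,0,0,1,1,1,1],
    [0,1,1,0,0,0,1,1,0,0], [0,0,1,1,1,0,0,1,1,1], [0,0,0,1,0,0,0,1], [0,0,1,0,0,0,1], [0,1,0,0,0,1],
    [0,1,1,1,0,0,1,1,1], [0,0,0,0,1,1,0,0,0,1], [0,0,0,1,1,0,0,0,1], [0,1,1,0,0,1,1,0],
    [0,0,0,1,1,0,0,1], [0,0,1,1,0,0,1], [0,1,1,0,0,1], [0,0,1,1,0,0,0,1], [0,1,1,0,0,0,1],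
    [0,1,1,1,1,0,0,1,1,1], [0,1,1,1,1,0,0,1,1], [0,0,0,0,1,1,0,0], [0,1,1,1,0,0,1,1], [0,1,1,1,0,0,1],
    [0,0,0,1,1,0,0], [0,0,1,1,0,0], [0,0,1,1,0], [0,1,1,0], [0,1,1,1,1,0,0,0,0,1,1,1,1,0,0],
    [0,0,0,0,1,1,1,1,0,0,0,0,1,1], [0,0,1,1,1,1,0,0,0,1,1,1,1,0], [0,0,1,1,1,1,0,0,0,1,1,1,1],
    [0,1,1,1,0,0,0,1,1,1,0,0], [0,0,0,0,1,1,1,0,0,0,1,1], [0,0,0,0,1,1,1,0,0,0,1],
    [0,0,0,1,1,1,0,0,0,1,1], [0,0,1,1,1,0,0,0,1,1], [0,0,1,1,1,0,0,0,1], [0,1,1,1,0,0,0,1],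
    [0,0,1,1,1,1,0,0,0,1,1,1], [0,1,1,1,1,0,0,0,1,1,1], [0,0,0,0,1,1,1,0,0,0], [0,0,0,1,1,1,0,0,0],
    [0,0,0,1,1,1,0,0], [0,0,1,1,1,0,0], [0,0,1,1,1,0], [0,1,1,1,0], [0,0,0,1,1,1,1,0,0,0,0,1,1],
    [0,0,1,1,1,1,0,0,0,0,1,1], [0,0,1,1,1,1,0,0,0,0,1], [0,0,1,1,1,1,0,0,0,0], [0,1,1,1,1,0,0,0,0],
    [0,0,0,0,1,1,1,1], [0,0,0,1,1,1,1], [0,0,0,1,1,1], [0,0,1,1,1], [0,1,1,1], [0,0,0,0], [0,1,1],
    [0,1], [0,0,0], [0,0], [0], []]"
    by code_simp
  then show ?thesis by (rule refutes_not_avoidable)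
qed

section \<open>Infinite words and uniform morphisms\<close>

definition factor :: "(nat \<Rightarrow> 'a) \<Rightarrow> nat \<Rightarrow> nat \<Rightarrow> 'a list" where
  "factor W i l = map W [i..<i + l]"

lemma length_factor [simp]: "length (factor W i l) = l"
  by (simp add: factor_def)

lemma nth_factor [simp]: "j < l \<Longrightarrow> factor W i l ! j = W (i + j)"
  by (simp add: factor_def)

lemma factor_0 [simp]: "factor W i 0 = []"
  by (simp add: factor_def)

lemma factor_Suc: "factor W i (Suc l) = W i # factor W (Suc i) l"
  by (simp add: factor_def upt_conv_Cons del: upt_Suc)

lemma factor_add: "factor W i (k + l) = factor W i k @ factor W (i + k) l"
  unfolding factor_def using upt_add_eq_append[of i "i + k" l] by (simp add: add.assoc)

lemma take_factor: "k \<le> l \<Longrightarrow> take k (factor W i l) = factor W i k"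
  using factor_add[of W i k "l - k"] by simp

lemma drop_factor: "k \<le> l \<Longrightarrow> drop k (factor W i l) = factor W (i + k) (l - k)"
  using factor_add[of W i k "l - k"] by simp

definition occurs :: "(nat \<Rightarrow> 'a) \<Rightarrow> nat \<Rightarrow> 'a list \<Rightarrow> bool" where
  "occurs W i u \<longleftrightarrow> factor W i (length u) = u"

lemma occurs_append: "occurs W i (u @ v) \<longleftrightarrow> occurs W i u \<and> occurs W (i + length u) v"
  by (simp add: occurs_def factor_add)

lemma occurs_prefix: "occurs W i u \<Longrightarrow> length u \<le> l \<Longrightarrow> prefix u (factor W i l)"
  unfolding occurs_def by (metis take_factor take_is_prefix)

lemma occurs_iff_nth: "occurs W i u \<longleftrightarrow> (\<forall>j < length u. W (i + j) = u ! j)"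
  unfolding occurs_def by (auto simp: list_eq_iff_nth_eq)

lemma avoidableI:
  assumes "\<And>i. W i < k"
    and none: "\<And>i x y. x \<noteq> [] \<Longrightarrow> y \<noteq> [] \<Longrightarrow> \<not> occurs W i (inst x y p)"
  shows "avoidable k p"
  unfolding avoidable_iff
proof
  fix n
  have "\<not> contains k p (factor W 0 n)"
  proof
    assume "contains k p (factor W 0 n)"
    then obtain x y where "x \<noteq> []" "y \<noteq> []" "sublist (inst x y p) (factor W 0 n)"
      unfolding contains_def by blast
    then obtain u v where "factor W 0 n = u @ inst x y p @ v" unfolding sublist_def by blast
    then have "occurs W 0 (u @ inst x y p @ v)" unfolding occurs_def by (metis length_factor)
    then have "occurs W (length u) (inst x y p)" by (simp add: occurs_append)
    with none \<open>x \<noteq> []\<close> \<open>y \<noteq> []\<close> show False by blast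
  qed
  moreover have "factor W 0 n \<in> lists {..<k}"
    using assms(1) by (auto simp: factor_def)
  ultimately show "\<exists>v \<in> lists {..<k}. n \<le> length v \<and> \<not> contains k p v"
    by (intro bexI[of _ "factor W 0 n"]) simp_all
qed

text \<open>For \<open>l = n\<close> this is a square of period \<open>n\<close>; for
  \<open>l = n - g\<close> with \<open>g \<le> n\<close> it is a near-square \<open>u v u\<close>
  with \<open>v\<close> of length \<open>g\<close>.\<close>

definition recurs :: "(nat \<Rightarrow> 'a) \<Rightarrow> nat \<Rightarrow> nat \<Rightarrow> nat \<Rightarrow> bool" where
  "recurs W i n l \<longleftrightarrow> (\<forall>j < l. W (i + j) = W (i + n + j))"

lemma recurs_iff_factor: "recurs W i n l \<longleftrightarrow> factor W i l = factor W (i + n) l"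
  by (auto simp: recurs_def list_eq_iff_nth_eq)

lemma recurs_mono: "recurs W i n l \<Longrightarrow> l' \<le> l \<Longrightarrow> recurs W i n l'"
  by (auto simp: recurs_def)

lemma occurs_recurs:
  assumes "occurs W i u" "occurs W (i + n) u"
  shows "recurs W i n (length u)"
  using assms by (auto simp: recurs_def occurs_iff_nth)

definition squarefree_word :: "(nat \<Rightarrow> 'a) \<Rightarrow> bool" where
  "squarefree_word w \<longleftrightarrow> (\<forall>i n. 0 < n \<longrightarrow> \<not> recurs w i n n)"

section \<open>Recurrences within finite windows\<close>

fun agree :: "nat \<Rightarrow> nat list \<Rightarrow> nat list \<Rightarrow> bool" where
  "agree 0 s t \<longleftrightarrow> True"
| "agree (Suc l) (a # s) (b # t) \<longleftrightarrow> a = b \<and> agree l s t"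
| "agree (Suc l) s t \<longleftrightarrow> False"

lemma agree_iff: "agree l s t \<longleftrightarrow> l \<le> length s \<and> l \<le> length t \<and> take l s = take l t"
  by (induction l s t rule: agree.induct) auto

text \<open>Shift and compared length grow together, so one pass treats all near-squares with the
  same gap over a range of distances.\<close>

fun no_agreement :: "nat list \<Rightarrow> nat list \<Rightarrow> nat \<Rightarrow> nat \<Rightarrow> bool" where
  "no_agreement s t l 0 \<longleftrightarrow> True"
| "no_agreement s [] l (Suc k) \<longleftrightarrow> True"
| "no_agreement s (b # t) l (Suc k) \<longleftrightarrow> \<not> agree l s (b # t) \<and> no_agreement s t (Suc l) k"

text \<open>Positivity of \<open>l + j\<close> excludes the empty agreement, the only one possible
  once \<open>t\<close> is exhausted.\<close>

lemma no_agreementD: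
  assumes "no_agreement s t l k" "j < k" "0 < l + j"
  shows "\<not> agree (l + j) s (drop j t)"
  using assms
proof (induction s t l k arbitrary: j rule: no_agreement.induct)
  case (3 s b t l k)
  then show ?case by (cases j) auto
qed (auto simp: agree_iff)

definition no_recurrence :: "nat \<Rightarrow> nat \<Rightarrow> nat \<Rightarrow> nat list \<Rightarrow> bool" where
  "no_recurrence n l k s \<longleftrightarrow> no_agreement s (drop n s) l k"

text \<open>The last bound places both occurrences inside the window, so a recurrence would show up
  as an agreement.\<close>

lemma no_recurrenceD:
  assumes "no_recurrence n l k (factor W i L)" "j < k" "0 < l + j" "n + j + (l + j) \<le> L"
  shows "\<not> recurs W i (n + j) (l + j)"
proof
  assume "recurs W i (n + j) (l + j)"
  with assms(4) have "agree (l + j) (factor W i L) (drop j (drop n (factor W i L)))"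
    by (simp add: agree_iff drop_factor take_factor recurs_iff_factor add.commute add.left_commute)
  with no_agreementD[OF assms(1)[unfolded no_recurrence_def] assms(2,3)] show False by blast
qed

section \<open>Squarefree ternary words of a given length\<close>

definition ternary_extensions :: "nat list \<Rightarrow> nat list list" where
  "ternary_extensions v = [0 # v, 1 # v, 2 # v]"

definition no_square_prefix :: "nat list \<Rightarrow> bool" where
  "no_square_prefix v \<longleftrightarrow> no_recurrence 1 1 (length v) v"

text \<open>Letters are added in front, so a new square can only be a prefix.\<close>

fun squarefree_words :: "nat \<Rightarrow> nat list list" where
  "squarefree_words 0 = [[]]"
| "squarefree_words (Suc n) =
    filter no_square_prefix (concat (map ternary_extensions (squarefree_words n)))"

lemma no_agreementI:
  assumes "\<And>j. j < k \<Longrightarrow> \<not> agree (l + j) s (drop j t)"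
  shows "no_agreement s t l k"
  using assms
proof (induction s t l k rule: no_agreement.induct)
  case (3 s b t l k)
  have "no_agreement s t (Suc l) k"
  proof (rule 3)
    fix j assume "j < k"
    then show "\<not> agree (Suc l + j) s (drop j t)" using "3.prems"[of "Suc j"] by simp
  qed
  then show ?case using "3.prems"[of 0] by simp
qed auto

lemma squarefree_words_complete:
  assumes "squarefree_word w" "\<And>i. w i < 3"
  shows "factor w i n \<in> set (squarefree_words n)"
proof (induction n arbitrary: i)
  case (Suc n)
  have "no_square_prefix (factor w i (Suc n))"
    unfolding no_square_prefix_def no_recurrence_def
  proof (rule no_agreementI, rule notI)
    fix j
    assume "agree (1 + j) (factor w i (Suc n)) (drop j (drop 1 (factor w i (Suc n))))"
    then have "recurs w i (Suc j) (Suc j)"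
      by (auto simp: agree_iff drop_factor take_factor recurs_iff_factor)
    with assms(1) show False unfolding squarefree_word_def by blast
  qed
  moreover have "w i = 0 \<or> w i = 1 \<or> w i = 2" using assms(2)[of i] by linarith
  ultimately show ?case
    using Suc.IH[of "Suc i"] by (auto simp: factor_Suc ternary_extensions_def)
qed simp

section \<open>Windows of images under uniform morphisms\<close>

fun columns :: "nat \<Rightarrow> nat \<Rightarrow> nat list list \<Rightarrow> nat list list list" where
  "columns l 0 bs = []"
| "columns l (Suc m) bs = map (take l) bs # columns l m (map tl bs)"

lemma length_columns [simp]: "length (columns l m bs) = m"
  by (induction m arbitrary: bs) simp_all

lemma nth_columns: "r < m \<Longrightarrow> columns l m bs ! r = map (\<lambda>b. take l (drop r b)) bs"
proof (induction m arbitrary: bs r)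
  case (Suc m)
  then show ?case by (cases r) (simp_all add: drop_Suc)
qed simp

definition image_word :: "nat \<Rightarrow> (nat \<Rightarrow> nat list) \<Rightarrow> (nat \<Rightarrow> nat) \<Rightarrow> nat \<Rightarrow> nat" where
  "image_word m h w i = h (w (i div m)) ! (i mod m)"

text \<open>Windows are grouped by their offset modulo \<open>m\<close>, so that different offsets
  can be compared when testing synchronisation.\<close>

definition image_windows :: "nat \<Rightarrow> (nat \<Rightarrow> nat list) \<Rightarrow> nat \<Rightarrow> nat list list \<Rightarrow> nat list list list" where
  "image_windows m h l vs = columns l m (map (concat \<circ> map h) vs)"

locale uniform_morphism =
  fixes m :: nat and h :: "nat \<Rightarrow> nat list"
  assumes m_pos: "0 < m" and length_h: "length (h a) = m"
begin

lemma image_word_block: "t < m \<Longrightarrow> image_word m h w (q * m + t) = h (w q) ! t"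
  by (simp add: image_word_def)

lemma factor_image_word:
  "factor (image_word m h w) (q * m) (k * m) = concat (map h (factor w q k))"
proof (induction k arbitrary: q)
  case (Suc k)
  have "factor (image_word m h w) (q * m) m = h (w q)"
    using length_h image_word_block[of _ w q] by (auto simp: list_eq_iff_nth_eq)
  with Suc[of "Suc q"] show ?case
    by (simp add: factor_add factor_Suc add.commute)
qed simp

text \<open>The offset is at most \<open>m - 1\<close>, and \<open>m - 1 + l \<le> k * m\<close>
  makes the images of \<open>k\<close> letters cover the window.\<close>

lemma factor_image_word_window:
  assumes "factor w (i div m) k \<in> set vs" "l + m \<le> Suc (k * m)"
  shows "factor (image_word m h w) i l \<in> set (image_windows m h l vs ! (i mod m))"
proof -
  let ?v = "factor w (i div m) k"
  have r: "i mod m < m" using m_pos by simp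
  have le: "i mod m + l \<le> k * m" using assms(2) r by linarith
  have "factor (image_word m h w) i l =
      take l (drop (i mod m) (factor (image_word m h w) (i div m * m) (k * m)))"
    using le by (simp add: drop_factor take_factor)
  also have "\<dots> = take l (drop (i mod m) (concat (map h ?v)))"
    by (simp add: factor_image_word)
  finally show ?thesis
    using assms(1) r by (auto simp: image_windows_def nth_columns)
qed

lemma factor_image_word_windows:
  assumes "factor w (i div m) k \<in> set vs" "l + m \<le> Suc (k * m)"
  shows "factor (image_word m h w) i l \<in> set (concat (image_windows m h l vs))"
proof -
  have "image_windows m h l vs ! (i mod m) \<in> set (image_windows m h l vs)"
    using m_pos by (intro nth_mem) (simp add: image_windows_def)
  with factor_image_word_window[OF assms] show ?thesis by (auto simp del: set_concat simp: set_concat)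
qed

text \<open>Up to \<open>g\<close> missing letters, a square in the image word still pulls back to a square: blocks are
  recognised by their first \<open>P\<close> or their last \<open>S\<close> letters, and \<open>P + S + g \<le> m + 1\<close> guarantees that
  one of the two markers survives in every block.\<close>

lemma recurs_image_word:
  fixes w :: "nat \<Rightarrow> nat"
  defines "W \<equiv> image_word m h w"
  assumes sync: "\<And>i j. factor W i \<rho> = factor W j \<rho> \<Longrightarrow> i mod m = j mod m"
    and pre: "\<And>i j. take P (h (w i)) = take P (h (w j)) \<Longrightarrow> w i = w j"
    and suf: "\<And>i j. drop (m - S) (h (w i)) = drop (m - S) (h (w j)) \<Longrightarrow> w i = w j"
    and PS: "0 < P" "0 < S" "P + S + g \<le> Suc m"
    and rec: "recurs W i n (n - g)" and n: "0 < n" "\<rho> + g \<le> n" "n \<noteq> m \<or> g = 0"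
  shows "\<exists>k j. 0 < k \<and> n = k * m \<and> recurs w j k k"
proof -
  \<comment> \<open>By \<open>\<rho> + g \<le> n\<close> at least \<open>\<rho>\<close> letters
    agree, which is enough to synchronise the two occurrences.\<close>
  have "factor W i \<rho> = factor W (i + n) \<rho>"
    using recurs_mono[OF rec] n(2) by (simp add: recurs_iff_factor)
  then have "i mod m = (i + n) mod m" by (rule sync)
  then have "m dvd n" by (metis add_diff_cancel_left' mod_eq_dvd_iff_nat le_add1)
  then obtain k where k: "n = k * m" by (metis dvd_def mult.commute)
  with n(1) have k_pos: "0 < k" by (cases k) auto
  have rec': "W (a + n) = W a" if "i \<le> a" "a < i + (n - g)" for a
  proof -
    have "W (i + (a - i)) = W (i + n + (a - i))"
      using rec[unfolded recurs_def, rule_format, of "a - i"] that by linarith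
    moreover have "i + (a - i) = a" "i + n + (a - i) = a + n" using that by linarith+
    ultimately show ?thesis by simp
  qed
  have blk: "h (w (q + k)) ! t = h (w q) ! t" if "t < m" "i \<le> q * m + t" "q * m + t < i + (n - g)" for q t
  proof -
    have "W (q * m + t + n) = W ((q + k) * m + t)" by (simp add: k algebra_simps)
    with rec'[of "q * m + t"] that show ?thesis
      unfolding W_def by (metis image_word_block)
  qed
  have pre': "w q = w (q + k)" if "i \<le> q * m" "q * m + P \<le> i + (n - g)" for q
  proof (rule pre, rule nth_equalityI)
    show "length (take P (h (w q))) = length (take P (h (w (q + k))))" by (simp add: length_h)
  next
    fix t assume "t < length (take P (h (w q)))"
    then have "t < P" "t < m" by (simp_all add: length_h)
    with blk[of t q] that show "take P (h (w q)) ! t = take P (h (w (q + k))) ! t" by simp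
  qed
  have suf': "w q = w (q + k)" if "i + S \<le> q * m + m" "q * m + m \<le> i + (n - g)" for q
  proof (rule suf, rule nth_equalityI)
    show "length (drop (m - S) (h (w q))) = length (drop (m - S) (h (w (q + k))))"
      by (simp add: length_h)
  next
    fix t assume "t < length (drop (m - S) (h (w q)))"
    then have t: "m - S + t < m" by (simp add: length_h)
    then have "h (w (q + k)) ! (m - S + t) = h (w q) ! (m - S + t)"
      using that PS by (intro blk) linarith+
    with t show "drop (m - S) (h (w q)) ! t = drop (m - S) (h (w (q + k))) ! t"
      by (simp add: length_h)
  qed
  \<comment> \<open>The first block whose last \<open>S\<close> letters all lie at or after position
    \<open>i\<close>.\<close>
  define q where "q = (i + S - 1) div m"
  have q1: "q * m \<le> i + S - 1" unfolding q_def by simp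
  have q2: "i + S \<le> q * m + m"
    using m_pos PS(2) div_mult_mod_eq[of "i + S - 1" m] mod_less_divisor[of m "i + S - 1"]
    unfolding q_def by linarith
  have "w (q + j) = w (q + k + j)" if j: "j < k" for j
  proof (cases "j = 0")
    case False
    \<comment> \<open>The later blocks start after \<open>i\<close>, and
      \<open>P + S + g \<le> Suc m\<close> keeps their first \<open>P\<close> letters inside the
      recurring part.\<close>
    then have "q * m + m \<le> (q + j) * m" by (cases j) simp_all
    moreover have "(q + j) * m + m \<le> q * m + n"
      using mult_le_mono1[of "Suc j" k m] j by (simp add: k algebra_simps)
    ultimately have "w (q + j) = w (q + j + k)"
      using q1 q2 PS n by (intro pre') linarith+
    then show ?thesis by (simp add: add.commute add.left_commute)
  next
    case True
    show ?thesis
    proof (cases "q * m + m \<le> i + (n - g)")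
      case True
      with suf'[OF q2] \<open>j = 0\<close> show ?thesis by simp
    next
      case False
      \<comment> \<open>If block \<open>q\<close> ends beyond the recurring part, then
        \<open>n < 2 * m\<close>, so \<open>n = m\<close> and hence \<open>g = 0\<close>. The block
        then starts after \<open>i\<close>, and its first \<open>P\<close> letters identify
        it.\<close>
      have "k = 1"
      proof (rule ccontr)
        assume "k \<noteq> 1"
        with k_pos have "2 * m \<le> n" using mult_le_mono1[of 2 k m] by (simp add: k)
        with False q1 PS show False by linarith
      qed
      with k n(3) have "n = m" "g = 0" by auto
      with False have "w q = w (q + k)"
        using q1 q2 PS by (intro pre') linarith+
      with \<open>j = 0\<close> show ?thesis by simp
    qed
  qed
  then have "recurs w q k k" unfolding recurs_def by blast
  with k k_pos show ?thesis by blast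
qed

end

section \<open>Periodic words\<close>

definition absent :: "nat list list \<Rightarrow> nat list \<Rightarrow> bool" where
  "absent us u \<longleftrightarrow> \<not> List.member us u"

definition disjoint_lists :: "nat list list \<Rightarrow> nat list list \<Rightarrow> bool" where
  "disjoint_lists us vs \<longleftrightarrow> list_all (absent us) vs"

fun disjoint_columns :: "nat list list list \<Rightarrow> bool" where
  "disjoint_columns [] \<longleftrightarrow> True"
| "disjoint_columns (c # cs) \<longleftrightarrow> list_all (disjoint_lists c) cs \<and> disjoint_columns cs"

lemma disjoint_columnsD:
  assumes "disjoint_columns cs" "r < length cs" "r' < length cs" "u \<in> set (cs ! r)" "u \<in> set (cs ! r')"
  shows "r = r'"
proof -
  have "\<not> r < r'" if "r' < length cs" "u \<in> set (cs ! r)" "u \<in> set (cs ! r')" for r r'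
    using assms(1) that
  proof (induction cs arbitrary: r r')
    case (Cons c cs)
    show ?case
    proof
      assume "r < r'"
      then obtain t where t: "r' = Suc t" by (cases r') auto
      with Cons.prems have "t < length cs" "u \<in> set (cs ! t)" by auto
      with Cons t \<open>r < r'\<close> show False
        by (cases r) (force simp: list_all_iff disjoint_lists_def absent_def)+
    qed
  qed simp
  with assms show ?thesis by (meson linorder_neqE_nat)
qed

section \<open>Search for instances in a window\<close>

fun matches :: "nat list \<Rightarrow> nat list \<Rightarrow> letter list \<Rightarrow> nat list \<Rightarrow> bool" where
  "matches x y [] s \<longleftrightarrow> True"
| "matches x y (a # p) s \<longleftrightarrow> prefix (img x y a) s \<and> matches x y p (drop (length (img x y a)) s)"

lemma matches_iff: "matches x y p s \<longleftrightarrow> prefix (inst x y p) s"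
proof (induction p arbitrary: s)
  case (Cons a p)
  show ?case unfolding matches.simps Cons by (auto simp: prefix_def)
qed simp

text \<open>The pattern meant is \<open>X # replicate k X @ Y # r\<close>. Given the lengths
  \<open>a\<close> and \<open>b\<close>, the window itself supplies both words, so only lengths are
  enumerated. In the part without \<open>Y\<close> the second word is the dummy
  \<open>[]\<close>.\<close>

fun no_instance_at :: "nat \<Rightarrow> letter list \<Rightarrow> nat list \<Rightarrow> nat \<times> nat \<Rightarrow> bool" where
  "no_instance_at k r s (a, b) \<longleftrightarrow>
    \<not> (matches (take a s) [] (replicate k X) (drop a s) \<and>
       matches (take a s) (take b (drop (Suc k * a) s)) r (drop (Suc k * a + b) s))"

definition no_instances :: "nat \<Rightarrow> letter list \<Rightarrow> (nat \<times> nat) list \<Rightarrow> nat list \<Rightarrow> bool" where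
  "no_instances k r lens s \<longleftrightarrow> list_all (no_instance_at k r s) lens"

fun no_X_instance_at :: "letter list \<Rightarrow> nat list \<Rightarrow> nat \<Rightarrow> bool" where
  "no_X_instance_at r s a \<longleftrightarrow> \<not> matches (take a s) [] r (drop a s)"

definition no_X_instances :: "letter list \<Rightarrow> nat list \<Rightarrow> nat list \<Rightarrow> bool" where
  "no_X_instances r as s \<longleftrightarrow> list_all (no_X_instance_at r s) as"

lemma inst_replicate_X: "inst x y (replicate k X) = concat (replicate k x)"
  by (induction k) simp_all

lemma length_concat_replicate: "length (concat (replicate k x)) = k * length x"
  by (induction k) simp_all

lemma no_instancesD:
  assumes "no_instances k r lens (factor W i L)" "(length x, length y) \<in> set lens"
    "length (inst x y (X # replicate k X @ Y # r)) \<le> L"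
  shows "\<not> occurs W i (inst x y (X # replicate k X @ Y # r))"
proof
  assume "occurs W i (inst x y (X # replicate k X @ Y # r))"
  from occurs_prefix[OF this assms(3)]
  obtain s where s: "factor W i L = x @ concat (replicate k x) @ y @ inst x y r @ s"
    by (auto simp: prefix_def inst_replicate_X)
  have d: "drop (Suc k * length x) (factor W i L) = y @ inst x y r @ s"
    using length_concat_replicate[of k x] unfolding s by simp
  have d': "drop (Suc k * length x + length y) (factor W i L) = inst x y r @ s"
    using d by (metis append_eq_conv_conj drop_drop add.commute)
  have "\<not> no_instance_at k r (factor W i L) (length x, length y)"
    using d d' by (simp add: matches_iff inst_replicate_X s del: mult_Suc)
  with assms(1,2) show False by (auto simp: no_instances_def list_all_iff)
qed

lemma inst_no_Y: "Y \<notin> set p \<Longrightarrow> YR \<notin> set p \<Longrightarrow> inst x y p = inst x [] p"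
proof (induction p)
  case (Cons a p)
  then show ?case by (cases a) simp_all
qed simp

lemma no_X_instancesD:
  assumes "no_X_instances r as (factor W i L)" "length x \<in> set as"
    "length (inst x y (X # r)) \<le> L" "Y \<notin> set r" "YR \<notin> set r"
  shows "\<not> occurs W i (inst x y (X # r))"
proof
  assume "occurs W i (inst x y (X # r))"
  from occurs_prefix[OF this assms(3)]
  obtain s where "factor W i L = x @ inst x [] r @ s"
    using inst_no_Y[OF assms(4,5), of x y] by (auto simp: prefix_def)
  then have "\<not> no_X_instance_at r (factor W i L) (length x)"
    by (simp add: matches_iff)
  with assms(1,2) show False by (auto simp: no_X_instances_def list_all_iff)
qed

section \<open>Shortening instances in periodic words\<close>

lemma occurs_add_periodic:
  assumes "\<And>i. W (i + m) = W i"
  shows "occurs W (i + d * m) u \<longleftrightarrow> occurs W i u"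
proof -
  have "W (j + d * m) = W j" for j
  proof (induction d)
    case (Suc d)
    have "W (j + Suc d * m) = W (j + d * m + m)" by (simp add: add.commute add.left_commute)
    with Suc assms show ?case by simp
  qed simp
  then have "W (i + d * m + j) = W (i + j)" for j
    by (metis add.commute add.left_commute)
  then show ?thesis by (simp add: occurs_iff_nth)
qed

text \<open>Removing whole periods from a block moves everything behind it by a multiple of
  \<open>m\<close>, which a periodic word does not notice.\<close>

lemma occurs_inst_shorten:
  assumes per: "\<And>i. W (i + m) = W i"
    and x: "length x = c + d * m" and y: "length y = c' + d' * m"
    and "occurs W i (inst x y p)"
  shows "occurs W i (inst (take c x) (take c' y) p)"
  using assms(4)
proof (induction p arbitrary: i)
  case (Cons a p)
  have occ: "occurs W i (img x y a)" "occurs W (i + length (img x y a)) (inst x y p)"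
    using Cons.prems by (simp_all add: occurs_append)
  have shift: "occurs W (j + (c + e * m)) u \<longleftrightarrow> occurs W (j + c) u" for j c e u
    using occurs_add_periodic[of W m, OF per, of "j + c" e u] by (simp add: add.assoc)
  have take: "occurs W i u \<Longrightarrow> length u = c + e * m \<Longrightarrow> occurs W i (take c u)" for u c e
    by (metis append_take_drop_id occurs_append)
  have drop: "occurs W i u \<Longrightarrow> length u = c + e * m \<Longrightarrow> occurs W i (drop (e * m) u)" for u c e
  proof -
    assume u: "occurs W i u" "length u = c + e * m"
    then have "occurs W i (take (e * m) u @ drop (e * m) u)" by simp
    then have "occurs W (i + e * m) (drop (e * m) u)"
      using u(2) unfolding occurs_append by simp
    then show "occurs W i (drop (e * m) u)" using occurs_add_periodic[of W m, OF per] by simp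
  qed
  \<comment> \<open>In \<open>rev u\<close> the reversed prefix stands at the end,
    \<open>e * m\<close> letters in, and is shifted back by \<open>e\<close> periods.\<close>
  have rev_take: "occurs W i (rev u) \<Longrightarrow> length u = c + e * m \<Longrightarrow> occurs W i (rev (take c u))" for u c e
    using drop[of "rev u" c e] by (simp add: rev_take)
  have "occurs W i (img (take c x) (take c' y) a)"
    using occ(1) take[OF _ x] take[OF _ y] rev_take[OF _ x] rev_take[OF _ y] by (cases a) simp_all
  moreover have "occurs W (i + length (img (take c x) (take c' y) a)) (inst x y p)"
    using occ(2) shift x y by (cases a) simp_all
  ultimately show ?case using Cons.IH by (simp add: occurs_append)
qed (simp add: occurs_def)

text \<open>The residue is taken in 1, ..., \<open>m\<close> instead of 0, ...,
  \<open>m - 1\<close>, so that a shortened word remains nonempty.\<close>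

lemma residue_split:
  fixes n m :: nat
  assumes "0 < n" "0 < m"
  obtains c d where "n = c + d * m" "1 \<le> c" "c \<le> m"
proof
  show "n = Suc ((n - 1) mod m) + ((n - 1) div m) * m" using assms(1) by simp
  show "1 \<le> Suc ((n - 1) mod m)" "Suc ((n - 1) mod m) \<le> m"
    using assms(2) by (simp_all add: Suc_leI)
qed

lemma length_inst_le:
  assumes "length x \<le> m" "length y \<le> m"
  shows "length (inst x y p) \<le> length p * m"
proof (induction p)
  case (Cons a p)
  have "length (img x y a) \<le> m" using assms by (cases a) simp_all
  with Cons show ?case by simp
qed simp

definition periodic_windows :: "nat list \<Rightarrow> nat \<Rightarrow> nat list list" where
  "periodic_windows u k =
    concat (columns (k * length u) (length u) [concat (replicate (Suc k) u)])"

text \<open>A periodic word is the image of a constant word under a constant uniform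
  morphism.\<close>

lemma factor_periodic:
  assumes "u \<noteq> []"
  defines "W \<equiv> \<lambda>i. u ! (i mod length u)"
  shows "factor W i (k * length u) \<in> set (periodic_windows u k)"
proof -
  let ?m = "length u"
  interpret uniform_morphism ?m "\<lambda>_. u"
    by unfold_locales (use assms in simp_all)
  have W: "W = image_word ?m (\<lambda>_. u) (\<lambda>_. 0)"
    by (simp add: W_def image_word_def fun_eq_iff)
  have f: "factor (\<lambda>_. 0) (i div ?m) (Suc k) = replicate (Suc k) (0 :: nat)"
    by (simp add: list_eq_iff_nth_eq del: replicate.simps)
  have "image_windows ?m (\<lambda>_. u) (k * ?m) [replicate (Suc k) 0] =
      columns (k * ?m) ?m [concat (replicate (Suc k) u)]"
    by (simp add: image_windows_def map_replicate_const)
  with factor_image_word_windows[of "\<lambda>_. 0" i "Suc k" "[replicate (Suc k) 0]" "k * ?m"] f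
  show ?thesis unfolding W periodic_windows_def by (simp del: replicate.simps set_concat)
qed

text \<open>Since \<open>k + length r + 2\<close> is the length of the pattern, the windows hold
  every instance whose blocks are no longer than the period.\<close>

definition periodic_avoids :: "nat list \<Rightarrow> nat \<Rightarrow> letter list \<Rightarrow> bool" where
  "periodic_avoids u k r \<longleftrightarrow> u \<noteq> [] \<and> list_all ((\<ge>) 1) u \<and>
    list_all (no_instances k r (List.product [1..<Suc (length u)] [1..<Suc (length u)]))
      (periodic_windows u (k + length r + 2))"

lemma periodic_avoidable:
  assumes "periodic_avoids u k r"
  shows "avoidable 2 (X # replicate k X @ Y # r)"
proof -
  let ?m = "length u" and ?p = "X # replicate k X @ Y # r"
  define W where "W = (\<lambda>i. u ! (i mod ?m))"
  have u: "u \<noteq> []" "\<And>a. a \<in> set u \<Longrightarrow> a < 2"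
    using assms by (auto simp: periodic_avoids_def list_all_iff)
  have per: "W (i + ?m) = W i" for i by (simp add: W_def)
  have none: "\<not> occurs W i (inst x y ?p)"
    if xy: "1 \<le> length x" "length x \<le> ?m" "1 \<le> length y" "length y \<le> ?m" for i x y
  proof (rule no_instancesD)
    show "no_instances k r (List.product [1..<Suc ?m] [1..<Suc ?m])
        (factor W i ((k + length r + 2) * ?m))"
      using assms factor_periodic[OF u(1), of i "k + length r + 2"]
      by (auto simp: periodic_avoids_def list_all_iff W_def)
    show "(length x, length y) \<in> set (List.product [1..<Suc ?m] [1..<Suc ?m])"
      using xy by auto
    show "length (inst x y ?p) \<le> (k + length r + 2) * ?m"
      using length_inst_le[OF xy(2,4), of ?p] by (simp add: add.commute add.left_commute)
  qed
  show ?thesis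
  proof (rule avoidableI)
    show "W i < 2" for i using u by (simp add: W_def)
  next
    fix i and x y :: "nat list"
    assume "x \<noteq> []" "y \<noteq> []"
    obtain c d where c: "length x = c + d * ?m" "1 \<le> c" "c \<le> ?m"
      using residue_split[of "length x" ?m] \<open>x \<noteq> []\<close> u(1) by auto
    obtain c' d' where c': "length y = c' + d' * ?m" "1 \<le> c'" "c' \<le> ?m"
      using residue_split[of "length y" ?m] \<open>y \<noteq> []\<close> u(1) by auto
    show "\<not> occurs W i (inst x y ?p)"
    proof
      assume "occurs W i (inst x y ?p)"
      then have "occurs W i (inst (take c x) (take c' y) ?p)"
        by (rule occurs_inst_shorten[of W, OF per c(1) c'(1)])
      moreover have "length (take c x) = c" "length (take c' y) = c'" using c(1) c'(1) by simp_all
      ultimately show False using none c c' by metis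
    qed
  qed
qed

lemma periodic_check:
  "list_all (periodic_avoids [0, 1] 1) [[X, YR], [XR, Y], [XR, YR], [Y, XR]]"
  "list_all (periodic_avoids [0, 1] 0) [[XR, XR, Y], [Y, XR]]"
  "periodic_avoids [0, 0, 1, 0, 1, 1] 0 [XR, YR, X]"
  "periodic_avoids [0, 0, 0, 1, 0, 1, 1] 0 [X, YR, XR]"
  by code_simp+

section \<open>Images of a squarefree ternary word\<close>

fun leech_block :: "nat \<Rightarrow> nat list" where
  "leech_block 0 = [0,1,2,1,0,2,1,2,0,1,2,1,0]"
| "leech_block (Suc 0) = [1,2,0,2,1,0,2,0,1,2,0,2,1]"
| "leech_block (Suc (Suc _)) = [2,0,1,0,2,1,0,1,2,0,1,0,2]"

function leech :: "nat \<Rightarrow> nat" where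
  "leech i = (if i = 0 then 0 else leech_block (leech (i div 13)) ! (i mod 13))"
  by auto
termination by (relation "measure id") auto

declare leech.simps [simp del]

text \<open>The fixed point property; at position 0 it holds because the block of 0 begins with
  0.\<close>

lemma leech_image: "image_word 13 leech_block leech = leech"
  by (rule ext) (simp add: image_word_def leech.simps)

text \<open>Different offsets share no window, so a window of length \<open>l\<close> determines its
  position modulo \<open>m\<close>.\<close>

definition sync_check :: "nat \<Rightarrow> (nat \<Rightarrow> nat list) \<Rightarrow> nat \<Rightarrow> nat \<Rightarrow> bool" where
  "sync_check m h l k \<longleftrightarrow>
    disjoint_columns (map remdups (image_windows m h l (squarefree_words k)))"

context uniform_morphism
begin

lemma sync_checkD:
  assumes "sync_check m h l k" "l + m \<le> Suc (k * m)" "\<And>q. factor w q k \<in> set (squarefree_words k)"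
    and eq: "factor (image_word m h w) i l = factor (image_word m h w) j l"
  shows "i mod m = j mod m"
proof -
  let ?cs = "map remdups (image_windows m h l (squarefree_words k))"
  have len: "length ?cs = m" by (simp add: image_windows_def)
  have "factor (image_word m h w) i' l \<in> set (?cs ! (i' mod m))" for i'
    using factor_image_word_window[OF assms(3) assms(2), of i'] len m_pos by simp
  from this[of i] this[of j, folded eq]
  show ?thesis
    using disjoint_columnsD[OF assms(1)[unfolded sync_check_def], of "i mod m" "j mod m"] len m_pos
    by simp
qed

end

interpretation leech: uniform_morphism 13 leech_block
proof
  show "length (leech_block a) = 13" for a by (cases a rule: leech_block.cases) simp_all
qed simp

lemma leech_check:
  "list_all (List.member (squarefree_words 2))
    (concat (image_windows 13 leech_block 2 (squarefree_words 2)))"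
  "sync_check 13 leech_block 8 2"
  "list_all (no_recurrence 1 1 7) (concat (image_windows 13 leech_block 14 (squarefree_words 2)))"
  by code_simp+

text \<open>A pair at \<open>i > 0\<close> lies in the image of the pair at
  \<open>i div 13 < i\<close>, and images of squarefree pairs contain only squarefree pairs.\<close>

lemma leech_pairs: "factor leech i 2 \<in> set (squarefree_words 2)"
proof (induction i rule: less_induct)
  case (less i)
  show ?case
  proof (cases "i = 0")
    case True
    have "leech 0 = 0" "leech 1 = 1" by (simp_all add: leech.simps)
    then have "factor leech 0 2 = [0, 1]" by (simp add: factor_def upt_rec)
    moreover have "List.member (squarefree_words 2) [0, 1]" by code_simp
    ultimately show ?thesis using True by simp
  next
    case False
    then have "factor leech (i div 13) 2 \<in> set (squarefree_words 2)" by (intro less) simp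
    from leech.factor_image_word_windows[OF this, of 2] leech_check(1)
    show ?thesis unfolding leech_image by (auto simp: list_all_iff simp del: squarefree_words.simps)
  qed
qed

lemma leech_less_3: "leech i < 3"
proof -
  have "list_all (list_all ((\<ge>) 2)) (squarefree_words 2)" by code_simp
  then have "\<forall>a \<in> set (factor leech i 2). a \<le> 2"
    using leech_pairs[of i] by (auto simp: list_all_iff)
  moreover have "leech i \<in> set (factor leech i 2)" by (simp add: factor_def)
  ultimately show ?thesis by force
qed

lemma leech_block_first_last:
  assumes "a < 3"
  shows "take 1 (leech_block a) = [a]" "drop 12 (leech_block a) = [a]"
proof -
  have "a = 0 \<or> a = 1 \<or> a = 2" using assms by linarith
  then show "take 1 (leech_block a) = [a]" "drop 12 (leech_block a) = [a]"
    by (auto simp: numeral_2_eq_2)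
qed

text \<open>Descent on the period: from 8 on, a square pulls back to one whose period is 13 times
  smaller. The block of \<open>a\<close> begins and ends with \<open>a\<close>, so single letters
  serve as markers.\<close>

lemma leech_squarefree: "squarefree_word leech"
  unfolding squarefree_word_def
proof (intro allI impI)
  fix i n :: nat
  assume "0 < n"
  then show "\<not> recurs leech i n n"
  proof (induction n arbitrary: i rule: less_induct)
    case (less n)
    show ?case
    proof (cases "n < 8")
      case True
      have "no_recurrence 1 1 7 (factor leech i 14)"
        using leech.factor_image_word_windows[of leech i 2 "squarefree_words 2" 14]
          leech_pairs leech_check(3)
        unfolding leech_image by (auto simp: list_all_iff simp del: squarefree_words.simps)
      from no_recurrenceD[OF this, of "n - 1"] True less.prems show ?thesis by simp
    next
      case False
      show ?thesis
      proof
        assume rec: "recurs leech i n n"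
        have "\<exists>k j. 0 < k \<and> n = k * 13 \<and> recurs leech j k k"
        proof (rule leech.recurs_image_word[where \<rho> = 8 and P = 1 and S = 1 and g = 0 and i = i])
          show "i mod 13 = j mod 13"
            if "factor (image_word 13 leech_block leech) i 8 = factor (image_word 13 leech_block leech) j 8"
            for i j
            using leech.sync_checkD[OF leech_check(2) _ leech_pairs that] by simp
          show "leech i = leech j" if "take 1 (leech_block (leech i)) = take 1 (leech_block (leech j))" for i j
            using that leech_less_3 leech_block_first_last(1) by (metis list.inject)
          show "leech i = leech j"
            if "drop (13 - 1) (leech_block (leech i)) = drop (13 - 1) (leech_block (leech j))" for i j
            using that leech_less_3 leech_block_first_last(2)
            by (metis list.inject numeral_eq_Suc diff_Suc_1 pred_numeral_simps(3) eval_nat_numeral(2) BitM.simps(2))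
          show "recurs (image_word 13 leech_block leech) i n (n - 0)"
            using rec unfolding leech_image by simp
        qed (use False in simp_all)
        with less show False by fastforce
      qed
    qed
  qed
qed

section \<open>Squares and near-squares in images of Leech's word\<close>

lemmas leech_factors = squarefree_words_complete[OF leech_squarefree leech_less_3]

text \<open>Here \<open>S\<close> counts the letters dropped in front of the suffix marker, not the
  length of that marker.\<close>

definition marked_check :: "(nat \<Rightarrow> nat list) \<Rightarrow> nat \<Rightarrow> nat \<Rightarrow> bool" where
  "marked_check h P S \<longleftrightarrow>
    distinct (map (take P) (map h [0, 1, 2])) \<and> distinct (map (drop S) (map h [0, 1, 2]))"

lemma less_3_cases: "(a :: nat) < 3 \<Longrightarrow> a = 0 \<or> a = 1 \<or> a = 2"
  by linarith

lemma (in uniform_morphism) recurs_image_leech: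
  assumes "sync_check m h \<rho> k" "\<rho> + m \<le> Suc (k * m)"
    and marked: "marked_check h P (m - S)" "0 < P" "0 < S" "P + S + g \<le> Suc m"
    and n: "\<rho> + g \<le> n" "0 < n" "n \<noteq> m \<or> g = 0"
  shows "\<not> recurs (image_word m h leech) i n (n - g)"
proof
  assume rec: "recurs (image_word m h leech) i n (n - g)"
  have "\<exists>k j. 0 < k \<and> n = k * m \<and> recurs leech j k k"
  proof (rule recurs_image_word[OF _ _ _ marked(2-4) rec n(2,1,3)])
    show "i mod m = j mod m"
      if "factor (image_word m h leech) i \<rho> = factor (image_word m h leech) j \<rho>" for i j
      by (rule sync_checkD[OF assms(1,2) leech_factors that])
    show "leech i = leech j" if "take P (h (leech i)) = take P (h (leech j))" for i j
      using that marked(1) less_3_cases[OF leech_less_3, of i] less_3_cases[OF leech_less_3, of j]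
      by (auto simp: marked_check_def)
    show "leech i = leech j" if "drop (m - S) (h (leech i)) = drop (m - S) (h (leech j))" for i j
      using that marked(1) less_3_cases[OF leech_less_3, of i] less_3_cases[OF leech_less_3, of j]
      by (auto simp: marked_check_def)
  qed
  with leech_squarefree show False unfolding squarefree_word_def by blast
qed

locale binary_uniform_morphism = uniform_morphism +
  assumes binary: "set (h a) \<subseteq> {..<2}"
begin

lemma image_word_less_2: "image_word m h w i < 2"
proof -
  have "image_word m h w i \<in> set (h (w (i div m)))"
    unfolding image_word_def using m_pos length_h by (intro nth_mem) simp
  with binary show ?thesis by blast
qed

end

text \<open>The blocks of the following morphisms were found by computer search.\<close>

fun cube_block :: "nat \<Rightarrow> nat list" where
  "cube_block 0 = [0,1,1,0,1,0,0,1,1]"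
| "cube_block (Suc 0) = [0,0,1,0,0,1,0,1,0]"
| "cube_block (Suc (Suc _)) = [0,1,0,1,1,0,0,1,1]"

interpretation cube: binary_uniform_morphism 9 cube_block
proof
  show "length (cube_block a) = 9" "set (cube_block a) \<subseteq> {..<2}" for a
    by (cases a rule: cube_block.cases; simp)+
qed simp

fun xxyyx_block :: "nat \<Rightarrow> nat list" where
  "xxyyx_block 0 = [1,1,0,1,1,1,1,0,1]"
| "xxyyx_block (Suc 0) = [1,1,0,1,0,0,0,0,1]"
| "xxyyx_block (Suc (Suc _)) = [1,1,0,0,0,1,0,0,1]"

interpretation xxyyx: binary_uniform_morphism 9 xxyyx_block
proof
  show "length (xxyyx_block a) = 9" "set (xxyyx_block a) \<subseteq> {..<2}" for a
    by (cases a rule: xxyyx_block.cases; simp)+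
qed simp

fun square_block :: "nat \<Rightarrow> nat list" where
  "square_block 0 = [0,1,0,0,0,1,1,0,1,0,1,0,0,0,0,1]"
| "square_block (Suc 0) = [1,0,0,0,1,0,1,0,1,1,1,0,0,0,0,1]"
| "square_block (Suc (Suc _)) = [1,0,0,1,0,1,0,1,1,1,1,0,0,0,0,1]"

interpretation square: binary_uniform_morphism 16 square_block
proof
  show "length (square_block a) = 16" "set (square_block a) \<subseteq> {..<2}" for a
    by (cases a rule: square_block.cases; simp)+
qed simp

fun reversal_block :: "nat \<Rightarrow> nat list" where
  "reversal_block 0 = [0,0,1,0,1,1,0,0,0,1,0,1,1,1,1,0,0,0,1,0,0,1,1,0,1,1,1,1]"
| "reversal_block (Suc 0) = [0,0,0,0,1,0,1,1,1,1,0,0,1,1,0,0,0,0,1,0,0,1,1,0,1,1,1,1]"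
| "reversal_block (Suc (Suc _)) = [0,0,0,1,0,1,1,1,0,0,1,0,1,1,0,0,0,0,1,0,0,1,1,0,1,1,1,1]"

interpretation reversal: binary_uniform_morphism 28 reversal_block
proof
  show "length (reversal_block a) = 28" "set (reversal_block a) \<subseteq> {..<2}" for a
    by (cases a rule: reversal_block.cases; simp)+
qed simp

lemma occurs_square: "occurs W i (u @ u @ v) \<Longrightarrow> recurs W i (length u) (length u)"
  unfolding occurs_append by (blast intro: occurs_recurs)

definition windows_check ::
    "nat \<Rightarrow> (nat \<Rightarrow> nat list) \<Rightarrow> nat \<Rightarrow> nat \<Rightarrow> (nat list \<Rightarrow> bool) \<Rightarrow> bool" where
  "windows_check m h l k Q \<longleftrightarrow>
    list_all Q (concat (map remdups (image_windows m h l (squarefree_words k))))"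

lemma (in uniform_morphism) windows_checkD:
  assumes "windows_check m h l k Q" "l + m \<le> Suc (k * m)"
  shows "Q (factor (image_word m h leech) i l)"
  using factor_image_word_windows[OF leech_factors assms(2), of i] assms(1)
  by (auto simp: windows_check_def list_all_iff)

text \<open>Distances from \<open>n0\<close> to \<open>n0 + c - 1\<close> are settled inside
  windows, the longest near-square having \<open>2 * (n0 + c - 1) - g\<close> letters; larger
  distances pull back to a square in Leech's word.\<close>

lemma (in uniform_morphism) near_square_image_leech:
  assumes "windows_check m h l k (no_recurrence n0 (n0 - g) c)" "l + m \<le> Suc (k * m)"
    and "2 * n0 + 2 * c \<le> l + g + 2" "g < n0" "\<rho> + g \<le> n0 + c" "n0 \<le> n" "n \<noteq> m \<or> g = 0"
    and sync: "sync_check m h \<rho> k'" "\<rho> + m \<le> Suc (k' * m)"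
    and marked: "marked_check h P (m - S)" "0 < P" "0 < S" "P + S + g \<le> Suc m"
  shows "\<not> recurs (image_word m h leech) i n (n - g)"
proof (cases "n < n0 + c")
  case True
  with no_recurrenceD[OF windows_checkD[OF assms(1,2)], where i = i and j = "n - n0"] assms(3-6)
  show ?thesis by simp
next
  case False
  show ?thesis
    by (rule recurs_image_leech[OF sync marked]) (use False assms(3-7) in linarith)+
qed

lemma cube_check:
  "sync_check 9 cube_block 11 3"
  "marked_check cube_block 3 3"
  "windows_check 9 cube_block 20 4 (no_recurrence 7 7 4)"
  "windows_check 9 cube_block 18 3 (no_X_instances [X, X] [1..<7])"
  by code_simp+

text \<open>Squares have period at most 6, so a cube would fit into a window of 18 letters.\<close>

lemma avoidable_xxx: "avoidable 2 [X, X, X]"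
proof -
  define W where "W = image_word 9 cube_block leech"
  have squares: "n \<le> 6" if "recurs W i n n" for i n
  proof (rule ccontr)
    assume "\<not> n \<le> 6"
    have "\<not> recurs W i n (n - 0)"
      unfolding W_def
      by (rule cube.near_square_image_leech[where l = 20 and k = 4 and ?n0.0 = 7 and c = 4 and
            \<rho> = 11 and k' = 3 and P = 3 and S = 6])
        (use \<open>\<not> n \<le> 6\<close> cube_check in simp_all)
    with that show False by simp
  qed
  show ?thesis
  proof (rule avoidableI)
    show "W i < 2" for i unfolding W_def by (rule cube.image_word_less_2)
  next
    fix i and x y :: "nat list"
    assume "x \<noteq> []"
    show "\<not> occurs W i (inst x y [X, X, X])"
    proof
      assume occ: "occurs W i (inst x y [X, X, X])"
      then have "length x \<le> 6"
        using squares[of i "length x"] occurs_square[of W i x x] \<open>x \<noteq> []\<close> by simp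
      with no_X_instancesD[OF cube.windows_checkD[OF cube_check(4)], where x = x and y = y] occ \<open>x \<noteq> []\<close>
      show False by (simp add: W_def Suc_le_eq)
    qed
  qed
qed

lemma xxyyx_check:
  "sync_check 9 xxyyx_block 8 2"
  "marked_check xxyyx_block 5 5"
  "windows_check 9 xxyyx_block 14 3 (no_recurrence 6 6 2)"
  "windows_check 9 xxyyx_block 25 4 (no_instances 1 [Y, X] (List.product [1..<6] [1..<6]))"
  by code_simp+

lemma avoidable_xxyyx: "avoidable 2 [X, X, Y, Y, X]"
proof -
  define W where "W = image_word 9 xxyyx_block leech"
  have squares: "n \<le> 5" if "recurs W i n n" for i n
  proof (rule ccontr)
    assume "\<not> n \<le> 5"
    have "\<not> recurs W i n (n - 0)"
      unfolding W_def
      by (rule xxyyx.near_square_image_leech[where l = 14 and k = 3 and ?n0.0 = 6 and c = 2 and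
            \<rho> = 8 and k' = 2 and P = 5 and S = 4])
        (use \<open>\<not> n \<le> 5\<close> xxyyx_check in simp_all)
    with that show False by simp
  qed
  show ?thesis
  proof (rule avoidableI)
    show "W i < 2" for i unfolding W_def by (rule xxyyx.image_word_less_2)
  next
    fix i and x y :: "nat list"
    assume "x \<noteq> []" "y \<noteq> []"
    show "\<not> occurs W i (inst x y [X, X, Y, Y, X])"
    proof
      assume occ: "occurs W i (inst x y [X, X, Y, Y, X])"
      then have xx: "occurs W i (x @ x @ y @ y @ x)"
        and yy: "occurs W (i + (length x + length x)) (y @ y @ x)"
        by (simp_all add: occurs_append add.assoc)
      note squares[OF occurs_square[OF xx]] squares[OF occurs_square[OF yy]]
      with no_instancesD[OF xxyyx.windows_checkD[OF xxyyx_check(4)], where x = x and y = y] occ \<open>x \<noteq> []\<close> \<open>y \<noteq> []\<close>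
      show False by (simp add: W_def Suc_le_eq)
    qed
  qed
qed

lemma square_check:
  "sync_check 16 square_block 10 2"
  "marked_check square_block 4 7"
  "windows_check 16 square_block 18 3 (no_recurrence 3 3 7)"
  "windows_check 16 square_block 20 3 (no_recurrence 10 8 2)"
  "windows_check 16 square_block 30 3 (no_recurrence 16 14 1)"
  "windows_check 16 square_block 12 2 (no_instances 1 [X, Y, Y] (List.product [1..<3] [1..<3]))"
  "windows_check 16 square_block 20 3 (no_instances 0 [X, X, Y] (List.product [1..<3] [1..<8]))"
  by code_simp+

lemma square_block_squares:
  assumes "recurs (image_word 16 square_block leech) i n n"
  shows "n \<le> 2"
proof (rule ccontr)
  assume "\<not> n \<le> 2"
  have "\<not> recurs (image_word 16 square_block leech) i n (n - 0)"
    by (rule square.near_square_image_leech[where l = 18 and k = 3 and ?n0.0 = 3 and c = 7 and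
          \<rho> = 10 and k' = 2 and P = 4 and S = 9])
      (use \<open>\<not> n \<le> 2\<close> square_check in simp_all)
  with assms show False by simp
qed

text \<open>Distance 16, the block length, is inspected separately because the pull-back excludes it
  for a positive gap.\<close>

lemma square_block_near_squares:
  assumes "recurs (image_word 16 square_block leech) i n (n - 2)"
  shows "n \<le> 9"
proof (rule ccontr)
  assume "\<not> n \<le> 9"
  show False
  proof (cases "n = 16")
    case True
    with no_recurrenceD[OF square.windows_checkD[OF square_check(5)], where i = i and j = 0] assms
    show False by simp
  next
    case False
    have "\<not> recurs (image_word 16 square_block leech) i n (n - 2)"
      by (rule square.near_square_image_leech[where l = 20 and k = 3 and ?n0.0 = 10 and c = 2 and
            \<rho> = 10 and k' = 2 and P = 4 and S = 9])
        (use \<open>\<not> n \<le> 9\<close> False square_check in simp_all)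
    with assms show False by simp
  qed
qed

lemma avoidable_xxyxyy: "avoidable 2 [X, X, Y, X, Y, Y]"
proof (rule avoidableI)
  show "image_word 16 square_block leech i < 2" for i by (rule square.image_word_less_2)
next
  fix i and x y :: "nat list"
  let ?W = "image_word 16 square_block leech"
  assume "x \<noteq> []" "y \<noteq> []"
  show "\<not> occurs ?W i (inst x y [X, X, Y, X, Y, Y])"
  proof
    assume occ: "occurs ?W i (inst x y [X, X, Y, X, Y, Y])"
    then have xx: "occurs ?W i (x @ x @ y @ x @ y @ y)"
      and yy: "occurs ?W (i + (length x + (length x + (length y + length x)))) (y @ y @ [])"
      by (simp_all add: occurs_append add.assoc)
    note square_block_squares[OF occurs_square[OF xx]] square_block_squares[OF occurs_square[OF yy]]
    with no_instancesD[OF square.windows_checkD[OF square_check(6)], where x = x and y = y] occ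
      \<open>x \<noteq> []\<close> \<open>y \<noteq> []\<close>
    show False by (simp add: Suc_le_eq)
  qed
qed

lemma avoidable_xyxxy: "avoidable 2 [X, Y, X, X, Y]"
proof (rule avoidableI)
  show "image_word 16 square_block leech i < 2" for i by (rule square.image_word_less_2)
next
  fix i and x y :: "nat list"
  let ?W = "image_word 16 square_block leech"
  assume "x \<noteq> []" "y \<noteq> []"
  show "\<not> occurs ?W i (inst x y [X, Y, X, X, Y])"
  proof
    assume occ: "occurs ?W i (inst x y [X, Y, X, X, Y])"
    then have xx: "occurs ?W (i + (length x + length y)) (x @ x @ y)"
      by (simp add: occurs_append add.assoc)
    have x: "length x \<le> 2" by (rule square_block_squares[OF occurs_square[OF xx]])
    have "occurs ?W i (x @ y)" "occurs ?W (i + (length x + length y + length x)) (x @ y)"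
      using occ by (simp_all add: occurs_append add.assoc)
    then have "recurs ?W i (length x + length y + length x) (length (x @ y))"
      by (rule occurs_recurs)
    \<comment> \<open>At this distance the repeated word \<open>x @ y\<close> misses only
      \<open>length x \<le> 2\<close> letters of a square.\<close>
    then have "length x + length y + length x \<le> 9"
      using x by (intro square_block_near_squares) (auto elim: recurs_mono)
    with x no_instancesD[OF square.windows_checkD[OF square_check(7)], where x = x and y = y] occ
      \<open>x \<noteq> []\<close> \<open>y \<noteq> []\<close>
    show False by (cases x) (auto simp: Suc_le_eq)
  qed
qed

section \<open>Factors occurring together with their reversals\<close>

definition reversal_free :: "nat list list \<Rightarrow> bool" where
  "reversal_free us \<longleftrightarrow> list_all (absent us) (map rev us)"

definition no_reversal_check :: "nat \<Rightarrow> (nat \<Rightarrow> nat list) \<Rightarrow> nat \<Rightarrow> nat \<Rightarrow> bool" where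
  "no_reversal_check m h l k \<longleftrightarrow>
    reversal_free (remdups (concat (image_windows m h l (squarefree_words k))))"

text \<open>The prefix of \<open>u\<close> of length \<open>l\<close> reappears reversed at the end
  of \<open>rev u\<close>, so a longer \<open>u\<close> would give two windows that are reversals of
  each other.\<close>

lemma (in uniform_morphism) no_reversal_checkD:
  assumes "no_reversal_check m h l k" "l + m \<le> Suc (k * m)"
    and "occurs (image_word m h leech) i u" "occurs (image_word m h leech) j (rev u)"
  shows "length u < l"
proof (rule ccontr)
  assume "\<not> length u < l"
  then have l: "l \<le> length u" by simp
  let ?W = "image_word m h leech"
  have "occurs ?W i (take l u)"
    using assms(3) occurs_append[of ?W i "take l u" "drop l u"] by simp
  moreover have "rev u = rev (drop l u) @ rev (take l u)" by (simp flip: rev_append)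
  then have "occurs ?W (j + (length u - l)) (rev (take l u))"
    using assms(4) occurs_append[of ?W j "rev (drop l u)" "rev (take l u)"] by simp
  ultimately have "factor ?W i l = take l u" "factor ?W (j + (length u - l)) l = rev (take l u)"
    using l by (simp_all add: occurs_def min_absorb2)
  then have "{take l u, rev (take l u)} \<subseteq> set (concat (image_windows m h l (squarefree_words k)))"
    using factor_image_word_windows[OF leech_factors assms(2)] by (metis empty_subsetI insert_subset)
  with assms(1) show False
    unfolding no_reversal_check_def reversal_free_def absent_def list_all_iff
    by (auto simp del: set_concat)
qed

text \<open>With the sum of the lengths at most 14, an instance with three blocks from
  \<open>x\<close> and two from \<open>y\<close> has at most \<open>28 + length x\<close> letters;
  this gives the window lengths 34 and 41 below.\<close>

definition pairs_below :: "nat \<Rightarrow> nat \<Rightarrow> nat \<Rightarrow> (nat \<times> nat) list" where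
  "pairs_below a b n = filter (\<lambda>(i, j). i + j \<le> n) (List.product [1..<Suc a] [1..<Suc b])"

lemma reversal_check:
  "sync_check 28 reversal_block 13 2"
  "marked_check reversal_block 4 10"
  "windows_check 28 reversal_block 24 2 (no_recurrence 5 5 8)"
  "windows_check 28 reversal_block 30 3 (no_recurrence 15 9 4)"
  "windows_check 28 reversal_block 50 3 (no_recurrence 28 22 1)"
  "no_reversal_check 28 reversal_block 7 2"
  "windows_check 28 reversal_block 15 2 (no_instances 0 [X, Y, X] (List.product [1..<4] [1..<4]))"
  "windows_check 28 reversal_block 15 2 (no_instances 0 [X, Y, XR] (List.product [1..<4] [1..<4]))"
  by code_simp+

lemma reversal_block_squares:
  assumes "recurs (image_word 28 reversal_block leech) i n n"
  shows "n \<le> 4"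
proof (rule ccontr)
  assume "\<not> n \<le> 4"
  have "\<not> recurs (image_word 28 reversal_block leech) i n (n - 0)"
    by (rule reversal.near_square_image_leech[where l = 24 and k = 2 and ?n0.0 = 5 and c = 8 and
          \<rho> = 13 and k' = 2 and P = 4 and S = 18])
      (use \<open>\<not> n \<le> 4\<close> reversal_check in simp_all)
  with assms show False by simp
qed

lemma reversal_block_near_squares:
  assumes "recurs (image_word 28 reversal_block leech) i n (n - 6)"
  shows "n \<le> 14"
proof (rule ccontr)
  assume "\<not> n \<le> 14"
  show False
  proof (cases "n = 28")
    case True
    with no_recurrenceD[OF reversal.windows_checkD[OF reversal_check(5)], where i = i and j = 0] assms
    show False by simp
  next
    case False
    have "\<not> recurs (image_word 28 reversal_block leech) i n (n - 6)"
      by (rule reversal.near_square_image_leech[where l = 30 and k = 3 and ?n0.0 = 15 and c = 4 and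
            \<rho> = 13 and k' = 2 and P = 4 and S = 18])
        (use \<open>\<not> n \<le> 14\<close> False reversal_check in simp_all)
    with assms show False by simp
  qed
qed

lemma reversal_block_xyxy:
  assumes "occurs (image_word 28 reversal_block leech) i (inst x y (X # Y # X # Y # r))"
  shows "length x + length y \<le> 4"
  using assms reversal_block_squares[of i "length (x @ y)"]
    occurs_square[of "image_word 28 reversal_block leech" i "x @ y" "inst x y r"] by simp

lemma avoidable_xyxyx: "avoidable 2 [X, Y, X, Y, X]"
proof (rule avoidableI)
  show "image_word 28 reversal_block leech i < 2" for i by (rule reversal.image_word_less_2)
next
  fix i and x y :: "nat list"
  assume "x \<noteq> []" "y \<noteq> []"
  then show "\<not> occurs (image_word 28 reversal_block leech) i (inst x y [X, Y, X, Y, X])"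
    using reversal_block_xyxy[of i x y "[X]"]
      no_instancesD[OF reversal.windows_checkD[OF reversal_check(7)], where x = x and y = y and i = i]
    by (cases x; cases y) auto
qed

lemma avoidable_xyxyxr: "avoidable 2 [X, Y, X, Y, XR]"
proof (rule avoidableI)
  show "image_word 28 reversal_block leech i < 2" for i by (rule reversal.image_word_less_2)
next
  fix i and x y :: "nat list"
  assume "x \<noteq> []" "y \<noteq> []"
  then show "\<not> occurs (image_word 28 reversal_block leech) i (inst x y [X, Y, X, Y, XR])"
    using reversal_block_xyxy[of i x y "[XR]"]
      no_instancesD[OF reversal.windows_checkD[OF reversal_check(8)], where x = x and y = y and i = i]
    by (cases x; cases y) auto
qed

lemma reversal_instance_check_xyxryx:
  "windows_check 28 reversal_block 34 3 (no_instances 0 [XR, Y, X] (pairs_below 6 14 14))"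
  by code_simp

lemma reversal_instance_check_xyxyrx:
  "windows_check 28 reversal_block 41 3 (no_instances 0 [X, YR, X] (pairs_below 14 6 14))"
  by code_simp

lemma set_pairs_below:
  "(a, b) \<in> set (pairs_below A B n) \<longleftrightarrow> 1 \<le> a \<and> a \<le> A \<and> 1 \<le> b \<and> b \<le> B \<and> a + b \<le> n"
  by (auto simp: pairs_below_def)

text \<open>Occurrence of \<open>x\<close> and \<open>rev x\<close> bounds \<open>x\<close> by 6
  letters; the two copies of \<open>y\<close> then form a near-square with gap at most 6, which
  bounds \<open>y\<close>.\<close>

lemma avoidable_xyxryx: "avoidable 2 [X, Y, XR, Y, X]"
proof (rule avoidableI)
  show "image_word 28 reversal_block leech i < 2" for i by (rule reversal.image_word_less_2)
next
  fix i and x y :: "nat list"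
  let ?W = "image_word 28 reversal_block leech"
  assume "x \<noteq> []" "y \<noteq> []"
  then have pos: "1 \<le> length x" "1 \<le> length y" by (simp_all add: Suc_le_eq)
  show "\<not> occurs ?W i (inst x y [X, Y, XR, Y, X])"
  proof
    assume occ: "occurs ?W i (inst x y [X, Y, XR, Y, X])"
    then have "occurs ?W i x" "occurs ?W (i + (length x + length y)) (rev x)"
      and y: "occurs ?W (i + length x) y" "occurs ?W (i + length x + (length y + length x)) y"
      by (simp_all add: occurs_append add.assoc)
    then have x: "length x < 7"
      using reversal.no_reversal_checkD[OF reversal_check(6)] by simp
    have "recurs ?W (i + length x) (length y + length x) (length y)"
      by (rule occurs_recurs[OF y])
    then have "length y + length x \<le> 14"
      using x by (intro reversal_block_near_squares) (auto elim: recurs_mono)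
    with x pos no_instancesD[OF reversal.windows_checkD[OF reversal_instance_check_xyxryx],
        where x = x and y = y] occ
    show False by (simp add: set_pairs_below)
  qed
qed

text \<open>Here \<open>y\<close> is bounded by its reversal, and \<open>x\<close> by the
  near-square formed by its first two copies around \<open>y\<close>.\<close>

lemma avoidable_xyxyrx: "avoidable 2 [X, Y, X, YR, X]"
proof (rule avoidableI)
  show "image_word 28 reversal_block leech i < 2" for i by (rule reversal.image_word_less_2)
next
  fix i and x y :: "nat list"
  let ?W = "image_word 28 reversal_block leech"
  assume "x \<noteq> []" "y \<noteq> []"
  then have pos: "1 \<le> length x" "1 \<le> length y" by (simp_all add: Suc_le_eq)
  show "\<not> occurs ?W i (inst x y [X, Y, X, YR, X])"
  proof
    assume occ: "occurs ?W i (inst x y [X, Y, X, YR, X])"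
    then have "occurs ?W (i + length x) y" "occurs ?W (i + (length x + (length y + length x))) (rev y)"
      and x: "occurs ?W i x" "occurs ?W (i + (length x + length y)) x"
      by (simp_all add: occurs_append add.assoc)
    then have y: "length y < 7"
      using reversal.no_reversal_checkD[OF reversal_check(6)] by simp
    have "recurs ?W i (length x + length y) (length x)"
      by (rule occurs_recurs[OF x])
    then have "length x + length y \<le> 14"
      using y by (intro reversal_block_near_squares) (auto elim: recurs_mono)
    with y pos no_instancesD[OF reversal.windows_checkD[OF reversal_instance_check_xyxyrx],
        where x = x and y = y] occ
    show False by (simp add: set_pairs_below)
  qed
qed

section \<open>The characterisation\<close>

text \<open>The last letter of \<open>x\<close> is doubled in the middle of the instance, but the
  alternating word has no two equal neighbours.\<close>

lemma avoidable_xxr: "avoidable 2 [X, XR]"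
proof (rule avoidableI)
  show "(\<lambda>i. i mod 2) i < (2 :: nat)" for i by simp
next
  fix i and x y :: "nat list"
  assume "x \<noteq> []"
  then obtain u c where x: "x = u @ [c]" by (metis rev_exhaust)
  show "\<not> occurs (\<lambda>i. i mod 2) i (inst x y [X, XR])"
  proof
    assume "occurs (\<lambda>i. i mod 2) i (inst x y [X, XR])"
    then have "occurs (\<lambda>i. i mod 2) (i + length u) [c, c]"
      using occurs_append[of _ "i + length u" "[c, c]" "rev u"] by (simp add: x occurs_append)
    then have "(i + length u) mod 2 = Suc (i + length u) mod 2"
      by (simp add: occurs_def factor_Suc)
    then show False by presburger
  qed
qed

lemma avoidable_periodic:
  "avoidable 2 [X, X, Y, X, YR]" "avoidable 2 [X, X, Y, XR, Y]" "avoidable 2 [X, X, Y, XR, YR]"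
  "avoidable 2 [X, X, Y, Y, XR]" "avoidable 2 [X, Y, XR, XR, Y]" "avoidable 2 [X, Y, Y, XR]"
  "avoidable 2 [X, Y, XR, YR, X]" "avoidable 2 [X, Y, X, YR, XR]"
  using periodic_check(1,2) periodic_avoidable[of "[0, 1]" 1] periodic_avoidable[of "[0, 1]" 0]
    periodic_avoidable[OF periodic_check(3)] periodic_avoidable[OF periodic_check(4)]
  by simp_all

lemma S2_avoidable: "s \<in> S2 \<Longrightarrow> avoidable 2 s"
  unfolding S2_def
  using avoidable_xxx avoidable_xxyxyy avoidable_xxyyx avoidable_xyxxy avoidable_xyxyx
    avoidable_xyxyxr avoidable_xyxryx avoidable_xyxyrx avoidable_xxr avoidable_periodic
  by blast

lemma max_unavoidable_not_avoidable:
  assumes "p \<in> set max_unavoidable"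
  shows "\<not> avoidable 2 p"
proof -
  have step: "avoidable 2 (iota1 q)" "avoidable 2 (iota2 q)" "avoidable 2 (iota3 q)"
    if "avoidable 2 q" for q
    using that pattern_equiv_avoidable pattern_equiv_iota by blast+
  have "\<not> avoidable 2 [X, Y, XR, Y]"
    \<comment> \<open>The chain runs through \<open>[XR, Y, X, Y]\<close> and
      \<open>[Y, X, Y, XR]\<close> to \<open>[X, Y, X, YR]\<close>.\<close>
    using step(2)[OF step(3)[OF step(1)[of "[X, Y, XR, Y]"]]] not_avoidable_xyxyr
    by (auto simp: iota1_def iota2_def iota3_def)
  moreover have "\<not> avoidable 2 [Y, X, Y, X, X]"
    using step(3)[of "[Y, X, Y, X, X]"] not_avoidable_xxyxy by (auto simp: iota3_def)
  ultimately show ?thesis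
    using assms not_avoidable_xyyx not_avoidable_xyxryr not_avoidable_xyxyr not_avoidable_xxyy
      not_avoidable_xxyxx not_avoidable_xxyxrxr not_avoidable_xxyxy
    unfolding max_unavoidable_def by auto
qed

theorem theorem8:
  fixes p :: "letter list"
  shows "avoidable 2 p \<longleftrightarrow> (\<exists>u. sublist u p \<and> ell u \<in> S2)"
proof
  assume p: "avoidable 2 p"
  show "\<exists>u. sublist u p \<and> ell u \<in> S2"
  proof (rule ccontr)
    assume "\<nexists>u. sublist u p \<and> ell u \<in> S2"
    then obtain q f where "q \<in> set max_unavoidable" "sublist f q" "pattern_equiv p f"
      by (meson S2_or_sublist_max)
    with p show False
      using pattern_equiv_avoidable avoidable_sublist max_unavoidable_not_avoidable by blast
  qed
next
  assume "\<exists>u. sublist u p \<and> ell u \<in> S2"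
  then show "avoidable 2 p"
    using S2_avoidable avoidable_ell avoidable_sublist by blast
qed

end
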